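(* Let $f\in C(Q,\mathbb{R})$ and $w\in C(Q,(0,\infty))$. Then $p_\sigma^w(f)$ has a unique continuous and $\sigma$-monotonic representative $f_0^*$, and $$a_{\hat\sigma,\mathrm{is}}^{w(\cdot\,\&\dot x)}\big(f(\cdot\,\&\dot x)\big)(\hat x)=f_0^*(x)=a_{\hat\sigma,\mathrm{si}}^{w(\cdot\,\&\dot x)}\big(f(\cdot\,\&\dot x)\big)(\hat x)\qquad\text{for all }x=\hat x\,\&\,\dot x\in Q.$$
   Context: Let $Q=[a_1,b_1]\times\dots\times[a_d,b_d]\subset\mathbb{R}^d$ with $a_i<b_i$, and $\sigma\in\{-1,0,1\}^d$. For $x,y\in\mathbb{R}^d$ write $x\le_\sigma y$ iff $\sigma_ix_i\le\sigma_iy_i$ for all $i$ with $\sigma_i=\pm1$ and $x_i=y_i$ for all $i$ with $\sigma_i=0$. For $X\subset\mathbb{R}^d$, a function $f:X\to\mathbb{R}$ is $\sigma$-monotonic iff $x\le_\sigma y$ implies $f(x)\le f(y)$ for all $x,y\in X$. $L^2_\sigma(Q,\mathbb{R})$ is the set of $f\in L^2(Q,\mathbb{R})$ (Lebesgue measure) such that some (equivalently every) representative $f_0$ of $f$ is $\sigma$-monotonic on $Q\setminus N$ for some null set $N$. For a measurable $w$ on $Q$ bounded above and below by positive constants and $f\in L^2(Q,\mathbb{R})$, $p_\sigma^w(f)$ denotes the unique minimizer of $g\mapsto\int_Q|f(x)-g(x)|^2w(x)\,dx$ over $g\in L^2_\sigma(Q,\mathbb{R})$. Splitting of coordinates: $\hat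 I:=\{i:\sigma_i=\pm1\}$, $\dot I:=\{i:\sigma_i=0\}$, $\hat Q:=\prod_{i\in\hat I}[a_i,b_i]$, $\dot Q:=\prod_{i\in\dot I}[a_i,b_i]$, $\hat\sigma:=(\sigma_i)_{i\in\hat I}$; for $x\in Q$, $\hat x:=(x_i)_{i\in\hat I}$, $\dot x:=(x_i)_{i\in\dot I}$ and $\hat x\,\&\,\dot x:=x$. Thus, for $\dot x\in\dot Q$, $f(\cdot\,\&\dot x)$ is the function $\hat Q\ni\hat y\mapsto f(\hat y\,\&\,\dot x)$. (An empty product of intervals is a one-point space, with Lebesgue measure the unit point mass.) Averaging expressions: let $R$ be a compact rectangle of the form of $Q$ and $\tau$ a signature for $R$ with all entries in $\{-1,1\}$. A set $L\subset R$ (resp. $U\subset R$) is a $\tau$-lower (resp. $\tau$-upper) set iff $x\le_\tau y$ in $R$ and $y\in L$ imply $x\in L$ (resp. $x\in U$ implies $y\in U$). For $x\in R$, $\mathcal{L}^{\mathrm{ro}}_\tau(x)$ (resp. $\mathcal{U}^{\mathrm{ro}}_\tau(x)$) is the set of all $\tau$-lower (resp. $\tau$-upper) sets in $R$ that are relatively open in $R$ and contain $x$. For bounded measurable $h:R\to\mathbb{R}$ and measurable $v:R\to\mathbb{R}$ bounded above and below by positive constants, and $E\subset R$ measurable with positive Lebesgue measure, $\operatorname{Av}_{h,v}(E):=\int_E h v\,d\lambda\big/\int_E v\,d\lambda$, and $$a_{\tau,\mathrm{is}}^v(h)(x):=\inf_{L\in\mathcal{L}^{\mathrm{ro}}_\tau(x)}\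 \sup_{U\in\mathcal{U}^{\mathrm{ro}}_\tau(x)}\operatorname{Av}_{h,v}(L\cap U),\qquad a_{\tau,\mathrm{si}}^v(h)(x):=\sup_{U\in\mathcal{U}^{\mathrm{ro}}_\tau(x)}\ \inf_{L\in\mathcal{L}^{\mathrm{ro}}_\tau(x)}\operatorname{Av}_{h,v}(L\cap U).$$ In the theorem these are used with $R=\hat Q$ and $\tau=\hat\sigma$. *)

theory Defs
  imports "HOL-Analysis.Analysis"
begin

text \<open>Points of $\mathbb{R}^I$, for a finite index set $I$, are encoded as functions
  \<open>nat \<Rightarrow> real\<close> in \<open>extensional I\<close>. This puts the rectangle \<open>Q\<close> and its two coordinate factors in
  one type; the topology of \<open>nat \<Rightarrow> real\<close> (product topology) induces the Euclidean one
  on \<open>extensional I\<close>, and \<^const>\<open>merge\<close> recombines points of the two factors.\<close>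

definition rect :: "nat set \<Rightarrow> (nat \<Rightarrow> real) \<Rightarrow> (nat \<Rightarrow> real) \<Rightarrow> (nat \<Rightarrow> real) set" where
  "rect I a b = (\<Pi>\<^sub>E i\<in>I. {a i..b i})"

text \<open>Lebesgue measure on $\mathbb{R}^I$; for \<open>I = {}\<close> the unit mass at the only point of
  \<open>extensional {}\<close>.\<close>

definition lebesgue_PiM :: "nat set \<Rightarrow> (nat \<Rightarrow> real) measure" where
  "lebesgue_PiM I = completion (\<Pi>\<^sub>M i\<in>I. lborel)"

definition sig_le :: "nat set \<Rightarrow> (nat \<Rightarrow> int) \<Rightarrow> (nat \<Rightarrow> real) \<Rightarrow> (nat \<Rightarrow> real) \<Rightarrow> bool" where
  "sig_le I \<sigma> x y \<longleftrightarrow>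
     (\<forall>i\<in>I. (\<sigma> i \<in> {-1, 1} \<longrightarrow> of_int (\<sigma> i) * x i \<le> of_int (\<sigma> i) * y i)
          \<and> (\<sigma> i = 0 \<longrightarrow> x i = y i))"

abbreviation sig_mono_on ::
  "nat set \<Rightarrow> (nat \<Rightarrow> int) \<Rightarrow> (nat \<Rightarrow> real) set \<Rightarrow> ((nat \<Rightarrow> real) \<Rightarrow> real) \<Rightarrow> bool" where
  "sig_mono_on I \<sigma> X f \<equiv> monotone_on X (sig_le I \<sigma>) (\<le>) f"

text \<open>Elements of $L^2$ are represented by functions; equality in $L^2$ is equality almost
  everywhere.\<close>

definition L2_on :: "nat set \<Rightarrow> (nat \<Rightarrow> real) set \<Rightarrow> ((nat \<Rightarrow> real) \<Rightarrow> real) set" where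
  "L2_on I Q = {f \<in> borel_measurable (restrict_space (lebesgue_PiM I) Q).
                  integrable (restrict_space (lebesgue_PiM I) Q) (\<lambda>x. (f x)\<^sup>2)}"

definition L2_eq ::
  "nat set \<Rightarrow> (nat \<Rightarrow> real) set \<Rightarrow> ((nat \<Rightarrow> real) \<Rightarrow> real) \<Rightarrow> ((nat \<Rightarrow> real) \<Rightarrow> real) \<Rightarrow> bool" where
  "L2_eq I Q f g \<longleftrightarrow> (AE x in restrict_space (lebesgue_PiM I) Q. f x = g x)"

definition L2_mono ::
  "nat set \<Rightarrow> (nat \<Rightarrow> int) \<Rightarrow> (nat \<Rightarrow> real) set \<Rightarrow> ((nat \<Rightarrow> real) \<Rightarrow> real) set" where
  "L2_mono I \<sigma> Q =
     {f \<in> L2_on I Q. \<exists>f\<^sub>0 \<in> L2_on I Q. L2_eq I Q f\<^sub>0 f \<and>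
        (\<exists>N \<in> null_sets (restrict_space (lebesgue_PiM I) Q). sig_mono_on I \<sigma> (Q - N) f\<^sub>0)}"

definition weighted_sq_dist ::
  "nat set \<Rightarrow> (nat \<Rightarrow> real) set \<Rightarrow> ((nat \<Rightarrow> real) \<Rightarrow> real) \<Rightarrow>
   ((nat \<Rightarrow> real) \<Rightarrow> real) \<Rightarrow> ((nat \<Rightarrow> real) \<Rightarrow> real) \<Rightarrow> real" where
  "weighted_sq_dist I Q w f g =
     (\<integral>x. \<bar>f x - g x\<bar>\<^sup>2 * w x \<partial>restrict_space (lebesgue_PiM I) Q)"

text \<open>\<open>g\<close> is a representative of the projection $p_\sigma^w(f)$, i.e. its class is the
  unique minimizer.\<close>

definition represents_proj ::
  "nat set \<Rightarrow> (nat \<Rightarrow> int) \<Rightarrow> (nat \<Rightarrow> real) set \<Rightarrow> ((nat \<Rightarrow> real) \<Rightarrow> real) \<Rightarrow>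
   ((nat \<Rightarrow> real) \<Rightarrow> real) \<Rightarrow> ((nat \<Rightarrow> real) \<Rightarrow> real) \<Rightarrow> bool" where
  "represents_proj I \<sigma> Q w f g \<longleftrightarrow>
     is_arg_min (weighted_sq_dist I Q w f) (\<lambda>h. h \<in> L2_mono I \<sigma> Q) g \<and>
     (\<forall>h. is_arg_min (weighted_sq_dist I Q w f) (\<lambda>h. h \<in> L2_mono I \<sigma> Q) h \<longrightarrow> L2_eq I Q h g)"

definition hat_coords :: "nat set \<Rightarrow> (nat \<Rightarrow> int) \<Rightarrow> nat set" where
  "hat_coords I \<sigma> = {i \<in> I. \<sigma> i \<in> {-1, 1}}"

definition dot_coords :: "nat set \<Rightarrow> (nat \<Rightarrow> int) \<Rightarrow> nat set" where
  "dot_coords I \<sigma> = {i \<in> I. \<sigma> i = 0}"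

text \<open>\<open>slice I \<sigma> f x\<close> is $f(\cdot\,\&\,\dot x)$; it depends on \<open>x\<close> only through $\dot x$.\<close>

definition slice ::
  "nat set \<Rightarrow> (nat \<Rightarrow> int) \<Rightarrow> ((nat \<Rightarrow> real) \<Rightarrow> real) \<Rightarrow> (nat \<Rightarrow> real) \<Rightarrow> (nat \<Rightarrow> real) \<Rightarrow> real" where
  "slice I \<sigma> f x =
     (\<lambda>y. f (merge (hat_coords I \<sigma>) (dot_coords I \<sigma>) (y, restrict x (dot_coords I \<sigma>))))"

definition lower_ro ::
  "nat set \<Rightarrow> (nat \<Rightarrow> int) \<Rightarrow> (nat \<Rightarrow> real) set \<Rightarrow> (nat \<Rightarrow> real) \<Rightarrow> (nat \<Rightarrow> real) set set" where
  "lower_ro I \<tau> R x =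
     {L. L \<subseteq> R \<and> (\<forall>y\<in>R. \<forall>z\<in>R. sig_le I \<tau> y z \<and> z \<in> L \<longrightarrow> y \<in> L)
       \<and> openin (top_of_set R) L \<and> x \<in> L}"

definition upper_ro ::
  "nat set \<Rightarrow> (nat \<Rightarrow> int) \<Rightarrow> (nat \<Rightarrow> real) set \<Rightarrow> (nat \<Rightarrow> real) \<Rightarrow> (nat \<Rightarrow> real) set set" where
  "upper_ro I \<tau> R x =
     {U. U \<subseteq> R \<and> (\<forall>y\<in>R. \<forall>z\<in>R. sig_le I \<tau> y z \<and> y \<in> U \<longrightarrow> z \<in> U)
       \<and> openin (top_of_set R) U \<and> x \<in> U}"

definition Av ::
  "nat set \<Rightarrow> ((nat \<Rightarrow> real) \<Rightarrow> real) \<Rightarrow> ((nat \<Rightarrow> real) \<Rightarrow> real) \<Rightarrow> (nat \<Rightarrow> real) set \<Rightarrow> real" where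
  "Av I h v E = (LINT y:E|lebesgue_PiM I. h y * v y) / (LINT y:E|lebesgue_PiM I. v y)"

definition av_is ::
  "nat set \<Rightarrow> (nat \<Rightarrow> int) \<Rightarrow> (nat \<Rightarrow> real) set \<Rightarrow> ((nat \<Rightarrow> real) \<Rightarrow> real) \<Rightarrow>
   ((nat \<Rightarrow> real) \<Rightarrow> real) \<Rightarrow> (nat \<Rightarrow> real) \<Rightarrow> real" where
  "av_is I \<tau> R v h x = (INF L\<in>lower_ro I \<tau> R x. SUP U\<in>upper_ro I \<tau> R x. Av I h v (L \<inter> U))"

definition av_si ::
  "nat set \<Rightarrow> (nat \<Rightarrow> int) \<Rightarrow> (nat \<Rightarrow> real) set \<Rightarrow> ((nat \<Rightarrow> real) \<Rightarrow> real) \<Rightarrow>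
   ((nat \<Rightarrow> real) \<Rightarrow> real) \<Rightarrow> (nat \<Rightarrow> real) \<Rightarrow> real" where
  "av_si I \<tau> R v h x = (SUP U\<in>upper_ro I \<tau> R x. INF L\<in>lower_ro I \<tau> R x. Av I h v (L \<inter> U))"

end

theory Submission
  imports Defs
begin

text \<open>Cut \<open>Q\<close> into \<open>n\<^sup>d\<close> congruent cells and let \<open>p\<close> be the weighted isotonic regression of the
  values of \<open>f\<close> at the cell corners, a finite-dimensional projection. The level sets
  \<open>{p > t}\<close> and \<open>{p < s}\<close> are optimal for thresholds \<open>t\<close> and \<open>s\<close>; comparing them with their translates by one cell
  shows that \<open>p\<close> changes by at most \<open>O(\<omega>)\<close> between neighbouring cells, where \<open>\<omega>\<close>
  is the oscillation of \<open>f\<close> and \<open>w\<close> on a cell. Testing the infimum over lower sets with (essentially)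
  the level set \<open>{p < t}\<close>, and dually, places both averaging expressions within \<open>O(\<omega>)\<close> of
  \<open>p\<close>, uniformly on \<open>Q\<close>. As \<open>n \<rightarrow> \<infinity>\<close> they therefore coincide, and they are a uniform limit of step functions whose
  jumps tend to \<open>0\<close>, hence continuous. The variational inequality of the projection
  passes from the grid to the limit by integrating over the position inside a cell. No
  compactness in \<open>L\<^sup>2\<close> is needed.\<close>

section \<open>Finite isotonic regression\<close>

text \<open>The finite projection is used through its variational inequality because this admits
  more tests than indicators of level sets: on \<open>{p < t}\<close> any nonnegative monotone
  \<open>g\<close> may be added to \<open>p\<close>. Such a \<open>g\<close> carries the translates
  in the jump estimate, the arbitrary upper set in an average, and the restriction to one slice.
  Coordinates with signature \<open>0\<close> are the obstacle to continuity, since the order never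
  compares different slices. The jump estimate overcomes this: translating a coordinate preserves
  the order whatever its signature is, so regularity in these directions is inherited from
  \<open>f\<close> and \<open>w\<close>. The basic error is \<omega> + 2M\<omega>/m: \<omega> for
  the change of \<open>f\<close>, and 2M\<omega> for the change of \<open>w\<close> against a
  residual of size at most 2M, divided by the lower bound m of the weight so that it acts as a shift
  of the threshold. Closed cells overlap in faces, and test sets must be relatively open; excluding
  whole closed cells costs one jump per coordinate, and comparing points with cell corners costs one
  more error of this size. This is the factor \<open>card I + 1\<close>. Each estimate is proved for
  one direction; negating \<open>f\<close> and \<open>\<sigma>\<close> gives the other.\<close>

definition isotonic_proj ::
  "'k set \<Rightarrow> ('k \<Rightarrow> 'k \<Rightarrow> bool) \<Rightarrow> ('k \<Rightarrow> real) \<Rightarrow> ('k \<Rightarrow> real) \<Rightarrow> ('k \<Rightarrow> real) \<Rightarrow> bool" where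
  "isotonic_proj K r w f p \<longleftrightarrow>
     monotone_on K r (\<le>) p \<and>
     (\<forall>g. monotone_on K r (\<le>) g \<longrightarrow> (\<Sum>k\<in>K. (f k - p k) * w k * (g k - p k)) \<le> 0)"

lemma isotonic_proj_uminus:
  assumes "isotonic_proj K r w f p"
  shows "isotonic_proj K (\<lambda>x y. r y x) w (\<lambda>k. - f k) (\<lambda>k. - p k)"
proof -
  have "(\<Sum>k\<in>K. (- f k - - p k) * w k * (g k - - p k)) \<le> 0"
    if g: "monotone_on K (\<lambda>x y. r y x) (\<le>) g" for g
  proof -
    have "monotone_on K r (\<le>) (\<lambda>k. - g k)"
      using g by (auto simp: monotone_on_def)
    then have "(\<Sum>k\<in>K. (f k - p k) * w k * (- g k - p k)) \<le> 0"
      using assms by (auto simp: isotonic_proj_def)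
    then show ?thesis
      by (simp add: algebra_simps)
  qed
  then show ?thesis
    using assms by (auto simp: isotonic_proj_def monotone_on_def)
qed

text \<open>The perturbation acts only below level \<open>t\<close> and is too small to lift
  \<open>p\<close> above \<open>t\<close>. It thus respects pairs inside \<open>{p < t}\<close> and
  pairs that leave this set upwards, and no pair enters it from above.\<close>

lemma isotonic_proj_upper:
  assumes K: "finite K" and p: "isotonic_proj K r w f p"
    and g: "monotone_on K r (\<le>) g" "\<And>k. k \<in> K \<Longrightarrow> 0 \<le> g k"
  shows "(\<Sum>k\<in>{k\<in>K. p k < t}. (f k - p k) * w k * g k) \<le> 0"
proof -
  \<comment> \<open>The \<open>1\<close> keeps the argument of \<open>Min\<close> nonempty when no
    \<open>k\<close> lies below \<open>t\<close>; the \<open>+ 1\<close> in the denominator admits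
    \<open>g k = 0\<close>.\<close>
  define \<epsilon> where "\<epsilon> = Min (insert 1 ((\<lambda>k. (t - p k) / (g k + 1)) ` {k\<in>K. p k < t}))"
  have \<epsilon>: "\<epsilon> > 0"
    unfolding \<epsilon>_def using K g(2) by (subst Min_gr_iff) (auto intro!: divide_pos_pos add_nonneg_pos)
  have le: "p k + \<epsilon> * g k \<le> t" if "k \<in> K" "p k < t" for k
  proof -
    have "\<epsilon> \<le> (t - p k) / (g k + 1)"
      unfolding \<epsilon>_def using K that by (intro Min_le) auto
    then have "\<epsilon> * (g k + 1) \<le> t - p k"
      using g(2)[OF that(1)] by (simp add: pos_le_divide_eq)
    then show ?thesis using \<epsilon> by (simp add: algebra_simps)
  qed
  define q where "q = (\<lambda>k. p k + (if p k < t then \<epsilon> * g k else 0))"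
  have "monotone_on K r (\<le>) q"
  proof (rule monotone_onI)
    fix k l assume kl: "k \<in> K" "l \<in> K" "r k l"
    have 1: "p k \<le> p l" "g k \<le> g l"
      using p g(1) kl by (auto simp: isotonic_proj_def monotone_on_def)
    show "q k \<le> q l"
      using 1 le[of k] kl \<epsilon> mult_left_mono[OF 1(2), of \<epsilon>] by (auto simp: q_def intro!: add_mono)
  qed
  then have "(\<Sum>k\<in>K. (f k - p k) * w k * (q k - p k)) \<le> 0"
    using p by (auto simp: isotonic_proj_def)
  also have "(\<Sum>k\<in>K. (f k - p k) * w k * (q k - p k)) =
      (\<Sum>k\<in>K. if p k < t then \<epsilon> * ((f k - p k) * w k * g k) else 0)"
    by (intro sum.cong) (auto simp: q_def)
  also have "\<dots> = \<epsilon> * (\<Sum>k\<in>{k\<in>K. p k < t}. (f k - p k) * w k * g k)"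
    using K by (auto simp: sum.inter_filter sum_distrib_left intro!: sum.cong)
  finally show ?thesis using \<epsilon> by (simp add: mult_le_0_iff)
qed

text \<open>On \<open>{p < t}\<close> the residual against \<open>t\<close> is smaller than the
  residual against \<open>p\<close>, so the unknown values of \<open>p\<close> disappear and only
  the threshold remains.\<close>

lemma isotonic_proj_upper':
  assumes K: "finite K" and p: "isotonic_proj K r w f p"
    and w: "\<And>k. k \<in> K \<Longrightarrow> 0 < w k"
    and g: "monotone_on K r (\<le>) g" "\<And>k. k \<in> K \<Longrightarrow> 0 \<le> g k"
  shows "(\<Sum>k\<in>{k\<in>K. p k < t}. (f k - t) * w k * g k) \<le> 0"
proof -
  have "(\<Sum>k\<in>{k\<in>K. p k < t}. (f k - t) * w k * g k) \<le> (\<Sum>k\<in>{k\<in>K. p k < t}. (f k - p k) * w k * g k)"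
    using w g(2) by (intro sum_mono mult_right_mono) (auto intro: less_imp_le)
  also have "\<dots> \<le> 0"
    by (rule isotonic_proj_upper[OF K p g])
  finally show ?thesis .
qed

lemma isotonic_proj_lower':
  assumes K: "finite K" and p: "isotonic_proj K r w f p"
    and w: "\<And>k. k \<in> K \<Longrightarrow> 0 < w k"
    and g: "monotone_on K (\<lambda>x y. r y x) (\<le>) g" "\<And>k. k \<in> K \<Longrightarrow> 0 \<le> g k"
  shows "(\<Sum>k\<in>{k\<in>K. p k > t}. (f k - t) * w k * g k) \<ge> 0"
proof -
  have "(\<Sum>k\<in>{k\<in>K. - p k < - t}. (- f k - - t) * w k * g k) \<le> 0"
    by (rule isotonic_proj_upper'[OF K isotonic_proj_uminus[OF p] w g])
  also have "(\<Sum>k\<in>{k\<in>K. - p k < - t}. (- f k - - t) * w k * g k)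
      = - (\<Sum>k\<in>{k\<in>K. p k > t}. (f k - t) * w k * g k)"
    by (simp add: sum_negf[symmetric] algebra_simps)
  finally show ?thesis by simp
qed

text \<open>If \<open>{p < m}\<close> were nonempty, every residual on it would be positive,
  contradicting the test function \<open>1\<close>.\<close>

lemma isotonic_proj_ge:
  assumes K: "finite K" and p: "isotonic_proj K r w f p"
    and w: "\<And>k. k \<in> K \<Longrightarrow> 0 < w k" and f: "\<And>k. k \<in> K \<Longrightarrow> m \<le> f k" and k: "k \<in> K"
  shows "m \<le> p k"
proof (rule ccontr)
  assume "\<not> m \<le> p k"
  have "0 < (\<Sum>k\<in>{k\<in>K. p k < m}. (f k - p k) * w k * 1)"
  proof (rule sum_pos)
    fix i assume i: "i \<in> {k\<in>K. p k < m}"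
    then have "0 < f i - p i" "0 < w i" using f[of i] w[of i] by auto
    then show "0 < (f i - p i) * w i * 1" by simp
  qed (use K k \<open>\<not> m \<le> p k\<close> in auto)
  moreover have "(\<Sum>k\<in>{k\<in>K. p k < m}. (f k - p k) * w k * 1) \<le> 0"
    by (rule isotonic_proj_upper[OF K p]) (auto simp: monotone_on_def)
  ultimately show False by simp
qed

lemma isotonic_proj_abs_le:
  assumes K: "finite K" and p: "isotonic_proj K r w f p"
    and w: "\<And>k. k \<in> K \<Longrightarrow> 0 < w k" and f: "\<And>k. k \<in> K \<Longrightarrow> \<bar>f k\<bar> \<le> M" and k: "k \<in> K"
  shows "\<bar>p k\<bar> \<le> M"
proof -
  have f': "- M \<le> f k" "- M \<le> - f k" if "k \<in> K" for k
    using f[OF that] by auto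
  show ?thesis
    using isotonic_proj_ge[OF K p w f'(1) k] 
      isotonic_proj_ge[OF K isotonic_proj_uminus[OF p] w f'(2) k] by auto
qed

text \<open>The left side is \<open>(f' - t) * w' + (f - f') * w' + (f - t) * (w - w')\<close>; both
  error terms are bounded by multiples of \<open>w'\<close>, the last one because
  \<open>w' / m \<ge> 1\<close>. An error proportional to the weight is the same as a shift of the
  threshold.\<close>

lemma weighted_residual_le:
  fixes f f' w w' t M m \<omega> :: real
  assumes "\<bar>f - f'\<bar> \<le> \<omega>" "\<bar>w - w'\<bar> \<le> \<omega>" "\<bar>f - t\<bar> \<le> 2 * M" "0 < m" "m \<le> w'"
  shows "(f - t) * w \<le> (f' - t + (\<omega> + 2 * M * \<omega> / m)) * w'"
proof -
  have "(f - f') * w' \<le> \<omega> * w'"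
    using assms by (intro mult_right_mono) auto
  moreover have "(f - t) * (w - w') \<le> 2 * M * \<omega>"
  proof -
    have "(f - t) * (w - w') \<le> \<bar>f - t\<bar> * \<bar>w - w'\<bar>"
      by (metis abs_ge_self abs_mult)
    also have "\<dots> \<le> 2 * M * \<omega>"
      using assms by (intro mult_mono) auto
    finally show ?thesis .
  qed
  moreover have "2 * M * \<omega> \<le> 2 * M * \<omega> / m * w'"
  proof -
    have "0 \<le> 2 * M * \<omega>" using assms by auto
    then have "2 * M * \<omega> / m * m \<le> 2 * M * \<omega> / m * w'"
      using assms by (intro mult_left_mono) auto
    then show ?thesis using assms by simp
  qed
  moreover have "(f' - t + (\<omega> + 2 * M * \<omega> / m)) * w' - (f - t) * w
     = \<omega> * w' - (f - f') * w' - (f - t) * (w - w') + 2 * M * \<omega> / m * w'"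
    by (simp add: algebra_simps)
  ultimately show ?thesis by linarith
qed

text \<open>The sets \<open>{p > t} \<inter> {p \<circ> S < s}\<close> and \<open>{p \<circ> S' > t} \<inter> {p < s}\<close> correspond
  under \<open>S\<close>; on the former the weighted mean of \<open>f\<close> is at least \<open>t\<close>, on the latter at
  most \<open>s\<close>.\<close>

lemma isotonic_proj_jump:
  fixes f w p :: "'k \<Rightarrow> real"
  assumes K: "finite K" and p: "isotonic_proj K r w f p"
    and m: "0 < m" "\<And>k. k \<in> K \<Longrightarrow> m \<le> w k" and M: "\<And>k. k \<in> K \<Longrightarrow> \<bar>f k\<bar> \<le> M"
    and S: "S \<in> K \<rightarrow> K" "\<And>k l. k \<in> K \<Longrightarrow> l \<in> K \<Longrightarrow> r k l \<Longrightarrow> r (S k) (S l)"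
    and S': "S' \<in> K \<rightarrow> K" "\<And>k l. k \<in> K \<Longrightarrow> l \<in> K \<Longrightarrow> r k l \<Longrightarrow> r (S' k) (S' l)"
    and SS': "\<And>k. k \<in> K \<Longrightarrow> S k = k \<or> S' (S k) = k" "\<And>k. k \<in> K \<Longrightarrow> S' k = k \<or> S (S' k) = k"
    and \<omega>: "\<And>k. k \<in> K \<Longrightarrow> \<bar>f k - f (S k)\<bar> \<le> \<omega>" "\<And>k. k \<in> K \<Longrightarrow> \<bar>w k - w (S k)\<bar> \<le> \<omega>"
    and k: "k \<in> K"
  shows "p k - p (S k) \<le> \<omega> + 2 * M * \<omega> / m"
proof (rule ccontr)
  define J where "J = \<omega> + 2 * M * \<omega> / m"
  assume "\<not> ?thesis"
  then have J: "p k - p (S k) > J" by (simp add: J_def)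
  have w: "0 < w k" if "k \<in> K" for k using m(1) m(2)[OF that] by simp
  have "0 \<le> \<omega>" "0 \<le> M" using \<omega>(1)[OF k] M[OF k] by auto
  then have "0 \<le> J" using m by (auto simp: J_def)
  \<comment> \<open>A third of the excess over \<open>J\<close>: moving both thresholds inwards by
    it still leaves \<open>t - s = J + \<epsilon>\<close>.\<close>
  define \<epsilon> where "\<epsilon> = (p k - p (S k) - J) / 3"
  define s t where "s = p (S k) + \<epsilon>" and "t = p k - \<epsilon>"
  have \<epsilon>: "\<epsilon> > 0" using J by (simp add: \<epsilon>_def)
  have st: "t - s > J" using J by (simp add: s_def t_def \<epsilon>_def field_simps)
  define E where "E = {k\<in>K. p k > t \<and> p (S k) < s}"
  have kE: "k \<in> E" using \<epsilon> k by (auto simp: E_def s_def t_def)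
  have "\<bar>p k\<bar> \<le> M" "\<bar>p (S k)\<bar> \<le> M"
    using S(1) k by (auto intro!: isotonic_proj_abs_le[OF K p w M])
  then have tM: "\<bar>t\<bar> \<le> M"
    using \<epsilon> st \<open>0 \<le> J\<close> by (auto simp: s_def t_def)
  have mono_p: "p k \<le> p l" if "k \<in> K" "l \<in> K" "r k l" for k l
    using p that by (auto simp: isotonic_proj_def monotone_on_def)
  have bij: "bij_betw S E {j\<in>K. p j < s \<and> p (S' j) > t}"
  proof (rule bij_betwI')
    \<comment> \<open>\<open>S\<close> may fix border indices, but none in \<open>E\<close>, where
      \<open>p k > t > s > p (S k)\<close>. This turns the alternatives in \<open>SS'\<close> into
      genuine inverses.\<close>
    have neq: "S k \<noteq> k" if "k \<in> E" for k
      using that st \<open>0 \<le> J\<close> by (auto simp: E_def)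
    show "(S x = S y) = (x = y)" if "x \<in> E" "y \<in> E" for x y
    proof -
      have "x \<in> K" "y \<in> K" using that by (auto simp: E_def)
      then show ?thesis using that neq SS'(1) by metis
    qed
    show "S x \<in> {j \<in> K. p j < s \<and> t < p (S' j)}" if "x \<in> E" for x
    proof -
      have "S' (S x) = x" using that neq[OF that] SS'(1)[of x] by (auto simp: E_def)
      moreover have "x \<in> K" "p x > t" "p (S x) < s" "S x \<in> K" using that S by (auto simp: E_def)
      ultimately show ?thesis by simp
    qed
    show "\<exists>x\<in>E. y = S x" if "y \<in> {j \<in> K. p j < s \<and> t < p (S' j)}" for y
    proof
      have "S' y \<noteq> y" using that st \<open>0 \<le> J\<close> by auto
      then have "S (S' y) = y" using SS'(2)[of y] that by auto
      then show "y = S (S' y)" "S' y \<in> E"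
        using that S' by (simp_all add: E_def Pi_iff)
    qed
  qed
  have "0 \<le> (\<Sum>k\<in>{k\<in>K. p k > t}. (f k - t) * w k * (if p (S k) < s then 1 else 0))"
  proof (rule isotonic_proj_lower'[OF K p w])
    show "monotone_on K (\<lambda>x y. r y x) (\<le>) (\<lambda>k. if p (S k) < s then 1 else (0::real))"
    proof (rule monotone_onI)
      fix k l assume "k \<in> K" "l \<in> K" "r l k"
      then have "p (S l) \<le> p (S k)" using S by (intro mono_p) auto
      then show "(if p (S k) < s then 1 else (0::real)) \<le> (if p (S l) < s then 1 else 0)" by auto
    qed
  qed auto
  also have "\<dots> = (\<Sum>k\<in>E. (f k - t) * w k)"
    using K by (intro sum.mono_neutral_cong_right) (auto simp: E_def)
  also have "\<dots> < (\<Sum>k\<in>E. (f (S k) - s) * w (S k))"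
  proof (rule sum_strict_mono)
    fix k assume "k \<in> E"
    then have k: "k \<in> K" "S k \<in> K" using S by (auto simp: E_def)
    have "(f k - t) * w k \<le> (f (S k) - t + J) * w (S k)"
      unfolding J_def using \<omega>[OF k(1)] M[OF k(1)] tM m(1) m(2)[OF k(2)]
      by (intro weighted_residual_le) auto
    also have "\<dots> < (f (S k) - s) * w (S k)"
      using st w[OF k(2)] by (intro mult_strict_right_mono) auto
    finally show "(f k - t) * w k < (f (S k) - s) * w (S k)" .
  qed (use K kE in \<open>auto simp: E_def\<close>)
  also have "\<dots> = (\<Sum>j\<in>{j\<in>K. p j < s \<and> p (S' j) > t}. (f j - s) * w j)"
    by (rule sum.reindex_bij_betw[OF bij, of "\<lambda>j. (f j - s) * w j"])
  also have "\<dots> = (\<Sum>j\<in>{j\<in>K. p j < s}. (f j - s) * w j * (if p (S' j) > t then 1 else 0))"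
    using K by (intro sum.mono_neutral_cong_left) auto
  also have "\<dots> \<le> 0"
  proof (rule isotonic_proj_upper'[OF K p w])
    show "monotone_on K r (\<le>) (\<lambda>j. if p (S' j) > t then 1 else (0::real))"
    proof (rule monotone_onI)
      fix k l assume "k \<in> K" "l \<in> K" "r k l"
      then have "p (S' k) \<le> p (S' l)" using S' by (intro mono_p) auto
      then show "(if p (S' k) > t then 1 else (0::real)) \<le> (if p (S' l) > t then 1 else 0)" by auto
    qed
  qed auto
  finally show False by simp
qed

section \<open>Existence of the finite projection\<close>

lemma nonpos_if_perturbation:
  fixes s q :: real
  assumes "\<And>\<epsilon>. 0 < \<epsilon> \<Longrightarrow> \<epsilon> \<le> 1 \<Longrightarrow> 2 * s \<le> \<epsilon> * q"
  shows "s \<le> 0"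
proof (rule ccontr)
  assume "\<not> s \<le> 0"
  then have s: "s > 0" by simp
  define \<epsilon> where "\<epsilon> = min 1 (s / (\<bar>q\<bar> + 1))"
  have \<epsilon>: "\<epsilon> > 0" "\<epsilon> \<le> 1" using s by (auto simp: \<epsilon>_def)
  then have "2 * s \<le> \<epsilon> * q" by (rule assms)
  also have "\<dots> \<le> \<epsilon> * (\<bar>q\<bar> + 1)"
    using \<epsilon> by (intro mult_left_mono) auto
  also have "\<dots> \<le> s / (\<bar>q\<bar> + 1) * (\<bar>q\<bar> + 1)"
    by (intro mult_right_mono) (auto simp: \<epsilon>_def)
  also have "\<dots> = s" by simp
  finally show False using s by simp
qed

text \<open>Truncating a competitor to \<open>{-B..B}\<close> keeps it monotone and takes it no
  farther from \<open>f\<close>, so minimising the weighted squares over a compact box suffices.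
  Moving from the minimiser towards \<open>g\<close> by a fraction \<epsilon>, and letting
  \<epsilon> tend to 0, gives the variational inequality.\<close>

lemma isotonic_proj_exists:
  fixes f w :: "'k \<Rightarrow> real"
  assumes K: "finite K" and w: "\<And>k. k \<in> K \<Longrightarrow> 0 < w k"
  shows "\<exists>p. isotonic_proj K r w f p"
proof -
  define B where "B = (\<Sum>k\<in>K. \<bar>f k\<bar>)"
  have fB: "\<bar>f k\<bar> \<le> B" if "k \<in> K" for k
    unfolding B_def using K that by (intro member_le_sum) auto
  have B0: "0 \<le> B" by (simp add: B_def sum_nonneg)
  define C where "C = Pi\<^sub>E K (\<lambda>_. {-B..B}) \<inter> {p. \<forall>k\<in>K. \<forall>l\<in>K. r k l \<longrightarrow> p k \<le> p l}"
  define Jf where "Jf = (\<lambda>p. \<Sum>k\<in>K. w k * (f k - p k)\<^sup>2)"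
  \<comment> \<open>Points of the box equal \<open>undefined\<close> off \<open>K\<close>. Written
    as a full product with singleton factors there, the box is compact by Tychonoff's
    theorem.\<close>
  have "compact (Pi\<^sub>E UNIV (\<lambda>k. if k \<in> K then {-B..B} else {undefined}))"
    using compactin_PiE[of "\<lambda>_. euclidean" UNIV "\<lambda>k. if k \<in> K then {-B..B} else {undefined :: real}"]
    by (auto simp: euclidean_product_topology)
  also have "Pi\<^sub>E UNIV (\<lambda>k. if k \<in> K then {-B..B} else {undefined}) = Pi\<^sub>E K (\<lambda>_. {-B..B})"
    by (auto simp: PiE_iff extensional_def split: if_splits)
  finally have compact_box: "compact (Pi\<^sub>E K (\<lambda>_. {-B..B}))" .
  have "closed {p. \<forall>k\<in>K. \<forall>l\<in>K. r k l \<longrightarrow> p k \<le> (p l :: real)}"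
    unfolding Ball_def
    by (intro closed_Collect_all closed_Collect_imp closed_Collect_le continuous_on_product_coordinates open_Collect_const)
  then have "compact C"
    unfolding C_def using compact_box by (rule compact_Int_closed[rotated])
  moreover have "(\<lambda>k\<in>K. 0) \<in> C" using B0 by (auto simp: C_def)
  moreover have "continuous_on C Jf"
    unfolding Jf_def by (intro continuous_intros continuous_on_subset[OF continuous_on_product_coordinates]) auto
  ultimately obtain p where p: "p \<in> C" "\<And>q. q \<in> C \<Longrightarrow> Jf p \<le> Jf q"
    using continuous_attains_inf[of C Jf] by blast
  have mono_p: "monotone_on K r (\<le>) p" using p(1) by (auto simp: C_def monotone_on_def)
  have min: "Jf p \<le> Jf g" if g: "monotone_on K r (\<le>) g" for g
  proof -
    have "Jf p \<le> Jf (\<lambda>k\<in>K. max (-B) (min B (g k)))"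
      by (rule p(2)) (use g B0 in \<open>fastforce simp: C_def monotone_on_def\<close>)
    also have "\<dots> \<le> Jf g"
      unfolding Jf_def
    proof (intro sum_mono mult_left_mono)
      fix k assume k: "k \<in> K"
      show "(f k - (\<lambda>k\<in>K. max (-B) (min B (g k))) k)\<^sup>2 \<le> (f k - g k)\<^sup>2"
        using fB[OF k] k by (subst abs_le_square_iff[symmetric]) auto
    qed (use w in \<open>auto intro: less_imp_le\<close>)
    finally show ?thesis .
  qed
  have "(\<Sum>k\<in>K. (f k - p k) * w k * (g k - p k)) \<le> 0" if g: "monotone_on K r (\<le>) g" for g
  proof (rule nonpos_if_perturbation)
    fix \<epsilon> :: real assume \<epsilon>: "0 < \<epsilon>" "\<epsilon> \<le> 1"
    define h where "h = (\<lambda>k. (1 - \<epsilon>) * p k + \<epsilon> * g k)"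
    have "monotone_on K r (\<le>) h"
      using g mono_p \<epsilon> by (auto simp: monotone_on_def h_def intro!: add_mono mult_left_mono)
    then have "Jf p \<le> Jf h" by (rule min)
    also have "Jf h = Jf p - 2 * \<epsilon> * (\<Sum>k\<in>K. (f k - p k) * w k * (g k - p k))
        + \<epsilon> * \<epsilon> * (\<Sum>k\<in>K. w k * (g k - p k)\<^sup>2)"
      unfolding Jf_def h_def sum_distrib_left sum_subtractf[symmetric] sum.distrib[symmetric]
      by (intro sum.cong) (auto simp: algebra_simps power2_eq_square)
    finally have "\<epsilon> * (2 * (\<Sum>k\<in>K. (f k - p k) * w k * (g k - p k)))
        \<le> \<epsilon> * (\<epsilon> * (\<Sum>k\<in>K. w k * (g k - p k)\<^sup>2))" by (simp add: mult_ac)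
    then show "2 * (\<Sum>k\<in>K. (f k - p k) * w k * (g k - p k)) \<le> \<epsilon> * (\<Sum>k\<in>K. w k * (g k - p k)\<^sup>2)"
      using \<epsilon> by simp
  qed
  then show ?thesis using mono_p by (auto simp: isotonic_proj_def)
qed

section \<open>Lebesgue measure on rectangles\<close>

text \<open>The distance is a series of truncated coordinate distances with weights
  \<open>(1/2)^n\<close>, of total weight 2, and coordinates off \<open>I\<close> agree. Later
  estimates can therefore speak of coordinates only.\<close>

lemma dist_fun_le_uniform:
  fixes x y :: "nat \<Rightarrow> real"
  assumes "x \<in> extensional I" "y \<in> extensional I" "\<And>i. i \<in> I \<Longrightarrow> \<bar>x i - y i\<bar> \<le> \<epsilon>" "0 \<le> \<epsilon>"
  shows "dist x y \<le> 2 * \<epsilon>"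
proof -
  have d: "dist (x i) (y i) \<le> \<epsilon>" for i
    using assms by (cases "i \<in> I") (auto simp: dist_real_def extensional_def)
  have "dist x y \<le> (\<Sum>n. (1/2)^n * \<epsilon>)"
    unfolding dist_fun_def
  proof (rule suminf_le)
    show "(1/2)^n * min (dist (x (from_nat n)) (y (from_nat n))) 1 \<le> (1/2)^n * \<epsilon>" for n
      using d[of "from_nat n"] by (intro mult_left_mono) auto
    show "summable (\<lambda>n. (1/2)^n * min (dist (x (from_nat n)) (y (from_nat n))) 1)"
      by (rule summable_comparison_test'[of "\<lambda>n. (1/2)^n"]) (auto simp: summable_geometric_iff)
    show "summable (\<lambda>n. (1/2)^n * \<epsilon>)"
      by (intro summable_mult2) (auto simp: summable_geometric_iff)
  qed
  also have "\<dots> = 2 * \<epsilon>"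
    by (subst suminf_mult2[symmetric]) (auto simp: summable_geometric_iff suminf_geometric)
  finally show ?thesis .
qed

lemma compact_rect: "compact (rect I a b)"
proof -
  have "compact (Pi\<^sub>E UNIV (\<lambda>i. if i \<in> I then {a i..b i} else {undefined}))"
    using compactin_PiE[of "\<lambda>_. euclidean" UNIV "\<lambda>i. if i \<in> I then {a i..b i} else {undefined}"]
    by (auto simp: euclidean_product_topology)
  also have "Pi\<^sub>E UNIV (\<lambda>i. if i \<in> I then {a i..b i} else {undefined}) = rect I a b"
    unfolding rect_def by (auto simp: PiE_iff extensional_def split: if_splits)
  finally show ?thesis .
qed

lemma rect_extensional: "x \<in> rect I a b \<Longrightarrow> x \<in> extensional I"
  by (simp add: rect_def PiE_def)

lemma continuous_on_rect_uniform:
  fixes f :: "(nat \<Rightarrow> real) \<Rightarrow> real"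
  assumes f: "continuous_on (rect I a b) f" and "0 < \<epsilon>"
  shows "\<exists>\<delta>>0. \<forall>x\<in>rect I a b. \<forall>y\<in>rect I a b. (\<forall>i\<in>I. \<bar>x i - y i\<bar> \<le> \<delta>) \<longrightarrow> \<bar>f x - f y\<bar> \<le> \<epsilon>"
proof -
  have "uniformly_continuous_on (rect I a b) f"
    by (rule compact_uniformly_continuous[OF f compact_rect])
  then obtain \<delta> where \<delta>: "\<delta> > 0"
    "\<And>x y. x \<in> rect I a b \<Longrightarrow> y \<in> rect I a b \<Longrightarrow> dist y x < \<delta> \<Longrightarrow> dist (f y) (f x) < \<epsilon>"
    using \<open>0 < \<epsilon>\<close> unfolding uniformly_continuous_on_def by blast
  show ?thesis
  proof (intro exI[of _ "\<delta> / 3"] conjI ballI impI)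
    fix x y assume xy: "x \<in> rect I a b" "y \<in> rect I a b" "\<forall>i\<in>I. \<bar>x i - y i\<bar> \<le> \<delta> / 3"
    have "dist x y \<le> 2 * (\<delta> / 3)"
      using xy \<delta>(1) by (intro dist_fun_le_uniform[of _ I]) (auto simp: rect_extensional)
    then show "\<bar>f x - f y\<bar> \<le> \<epsilon>"
      using \<delta>(2)[OF xy(2,1)] \<delta>(1) by (auto simp: dist_real_def)
  qed (use \<delta> in auto)
qed

lemma openin_rect_nbhd:
  assumes E: "openin (top_of_set (rect I a b)) E" and x: "x \<in> E"
  shows "\<exists>\<epsilon>>0. \<forall>y\<in>rect I a b. (\<forall>i\<in>I. \<bar>x i - y i\<bar> \<le> \<epsilon>) \<longrightarrow> y \<in> E"
proof -
  obtain e where e: "e > 0" "ball x e \<inter> rect I a b \<subseteq> E"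
    using E x unfolding openin_contains_ball by blast
  have xr: "x \<in> rect I a b" using E x openin_subset[OF E] by auto
  show ?thesis
  proof (intro exI[of _ "e / 3"] conjI ballI impI)
    fix y assume y: "y \<in> rect I a b" "\<forall>i\<in>I. \<bar>x i - y i\<bar> \<le> e / 3"
    have "dist x y \<le> 2 * (e / 3)"
      using xr y e by (intro dist_fun_le_uniform[of _ I]) (auto simp: rect_extensional)
    then show "y \<in> E" using e y by auto
  qed (use e in auto)
qed

interpretation lborel_PiM: product_sigma_finite "\<lambda>_ :: nat. lborel :: real measure"
  by standard

abbreviation lborel_Pi :: "nat set \<Rightarrow> (nat \<Rightarrow> real) measure" where
  "lborel_Pi I \<equiv> PiM I (\<lambda>_. lborel)"

text \<open>Links the product sigma-algebra over \<open>I\<close> with the Borel sets of the full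
  function space, where openness and continuity live; coordinates off \<open>I\<close> are constant
  on the smaller space.\<close>

lemma measurable_ident_PiM_borel: "(\<lambda>x. x) \<in> lborel_Pi I \<rightarrow>\<^sub>M borel"
proof (rule measurable_coordinatewise_then_product)
  fix i
  show "(\<lambda>x. x i) \<in> borel_measurable (lborel_Pi I)"
  proof (cases "i \<in> I")
    case True
    then have "(\<lambda>x. x i) \<in> lborel_Pi I \<rightarrow>\<^sub>M lborel" by (rule measurable_component_singleton)
    then show ?thesis by simp
  next
    case False
    then have "x i = undefined" if "x \<in> space (lborel_Pi I)" for x
      using that by (auto simp: space_PiM PiE_iff extensional_def)
    then show ?thesis by (subst measurable_cong[where g="\<lambda>_. undefined"]) auto
  qed
qed

lemma sets_rect: "finite I \<Longrightarrow> rect I a b \<in> sets (lborel_Pi I)"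
  unfolding rect_def by (intro sets_PiM_I_finite) auto

lemma sets_openin_rect:
  assumes "finite I" "openin (top_of_set (rect I a b)) E"
  shows "E \<in> sets (lborel_Pi I)"
proof -
  obtain T where T: "open T" "E = rect I a b \<inter> T"
    using assms(2) by (auto simp: openin_open)
  have "(\<lambda>x. x) -` T \<inter> space (lborel_Pi I) \<in> sets (lborel_Pi I)"
    using T by (intro measurable_sets[OF measurable_ident_PiM_borel]) auto
  then have "(T \<inter> space (lborel_Pi I)) \<inter> rect I a b \<in> sets (lborel_Pi I)"
    using sets_rect[OF assms(1)] by (auto intro: sets.Int)
  also have "(T \<inter> space (lborel_Pi I)) \<inter> rect I a b = E"
    using T by (auto simp: space_PiM rect_def)
  finally show ?thesis .
qed

lemma measurable_continuous_on_rect: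
  fixes f :: "(nat \<Rightarrow> real) \<Rightarrow> real"
  assumes "finite I" "continuous_on (rect I a b) f"
  shows "(\<lambda>x. indicator (rect I a b) x * f x) \<in> borel_measurable (lborel_Pi I)"
proof -
  have "closed (rect I a b)" by (intro compact_imp_closed compact_rect)
  then have "(\<lambda>x. indicator (rect I a b) x *\<^sub>R f x) \<in> borel_measurable borel"
    by (intro borel_measurable_continuous_on_indicator assms) auto
  from measurable_compose[OF measurable_ident_PiM_borel this] show ?thesis by simp
qed

lemma emeasure_rect:
  assumes "finite I" "\<And>i. i \<in> I \<Longrightarrow> a i \<le> b i"
  shows "emeasure (lborel_Pi I) (rect I a b) = ennreal (\<Prod>i\<in>I. b i - a i)"
  unfolding rect_def using assms
  by (subst lborel_PiM.emeasure_PiM) (auto simp: prod_ennreal)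

text \<open>The point may lie on the boundary, so a small cube around it is clipped to the
  rectangle; the clipped sides stay nondegenerate because \<open>a i < b i\<close>.\<close>

lemma emeasure_openin_rect_pos:
  assumes I: "finite I" and ab: "\<And>i. i \<in> I \<Longrightarrow> a i < b i"
    and E: "openin (top_of_set (rect I a b)) E" and x: "x \<in> E"
  shows "0 < emeasure (lborel_Pi I) E"
proof -
  obtain \<epsilon> where \<epsilon>: "\<epsilon> > 0" "\<And>y. y \<in> rect I a b \<Longrightarrow> (\<And>i. i \<in> I \<Longrightarrow> \<bar>x i - y i\<bar> \<le> \<epsilon>) \<Longrightarrow> y \<in> E"
    using openin_rect_nbhd[OF E x] by blast
  have xr: "x \<in> rect I a b" using x openin_subset[OF E] by auto
  then have xi: "a i \<le> x i" "x i \<le> b i" if "i \<in> I" for i using that by (auto simp: rect_def)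
  define c d where "c i = max (a i) (x i - \<epsilon>)" and "d i = min (b i) (x i + \<epsilon>)" for i
  have cd: "c i < d i" if "i \<in> I" for i
    using xi[OF that] ab[OF that] \<epsilon>(1) by (auto simp: c_def d_def)
  have "rect I c d \<subseteq> E"
  proof
    fix y assume y: "y \<in> rect I c d"
    then have yi: "c i \<le> y i" "y i \<le> d i" if "i \<in> I" for i using that by (auto simp: rect_def)
    show "y \<in> E"
    proof (rule \<epsilon>(2))
      show "y \<in> rect I a b"
        using y by (auto simp: rect_def c_def d_def PiE_iff)
      show "\<bar>x i - y i\<bar> \<le> \<epsilon>" if "i \<in> I" for i
        using yi[OF that] by (auto simp: c_def d_def)
    qed
  qed
  then have "emeasure (lborel_Pi I) (rect I c d) \<le> emeasure (lborel_Pi I) E"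
    by (intro emeasure_mono sets_openin_rect[OF I E])
  moreover have "0 < emeasure (lborel_Pi I) (rect I c d)"
    using I cd by (subst emeasure_rect) (auto intro!: prod_pos less_imp_le)
  ultimately show ?thesis by (meson less_le_trans)
qed

lemma distr_lborel_Pi_translate:
  assumes I: "finite I"
  shows "distr (lborel_Pi I) (lborel_Pi I) (\<lambda>x. \<lambda>i\<in>I. x i + c i) = lborel_Pi I"
proof (rule lborel_PiM.PiM_eqI[OF I])
  have m: "(\<lambda>x. \<lambda>i\<in>I. x i + c i) \<in> lborel_Pi I \<rightarrow>\<^sub>M lborel_Pi I"
    by (intro measurable_restrict) measurable
  fix A assume A: "\<And>i. i \<in> I \<Longrightarrow> A i \<in> sets (lborel :: real measure)"
  have *: "(\<lambda>x. \<lambda>i\<in>I. x i + c i) -` Pi\<^sub>E I A \<inter> space (lborel_Pi I) = Pi\<^sub>E I (\<lambda>i. (\<lambda>x. x + c i) -` A i)"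
    by (auto simp: space_PiM PiE_iff extensional_def)
  have A': "(\<lambda>x. x + c i) -` A i \<in> sets lborel" if "i \<in> I" for i
    using measurable_sets[of "\<lambda>x. x + c i" lborel borel "A i"] A[OF that] by auto
  have "emeasure (distr (lborel_Pi I) (lborel_Pi I) (\<lambda>x. \<lambda>i\<in>I. x i + c i)) (Pi\<^sub>E I A)
      = emeasure (lborel_Pi I) (Pi\<^sub>E I (\<lambda>i. (\<lambda>x. x + c i) -` A i))"
    using I A by (subst emeasure_distr[OF m]) (auto intro: sets_PiM_I_finite simp: *)
  also have "\<dots> = (\<Prod>i\<in>I. emeasure lborel ((\<lambda>x. x + c i) -` A i))"
    using I A' by (subst lborel_PiM.emeasure_PiM) auto
  also have "\<dots> = (\<Prod>i\<in>I. emeasure lborel (A i))"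
  proof (intro prod.cong refl)
    fix i assume "i \<in> I"
    have "emeasure lborel (A i) = emeasure (distr lborel borel ((+) (c i))) (A i)"
      by (simp add: lborel_distr_plus)
    also have "\<dots> = emeasure lborel ((\<lambda>x. x + c i) -` A i)"
      using A[OF \<open>i \<in> I\<close>] by (subst emeasure_distr) (auto simp: add.commute[of _ "c i"])
    finally show "emeasure lborel ((\<lambda>x. x + c i) -` A i) = emeasure lborel (A i)" by simp
  qed
  finally show "emeasure (distr (lborel_Pi I) (lborel_Pi I) (\<lambda>x. \<lambda>i\<in>I. x i + c i)) (Pi\<^sub>E I A)
      = (\<Prod>i\<in>I. emeasure lborel (A i))" .
qed simp

lemma AE_lborel_Pi_component_neq:
  assumes I: "finite I" and i: "i \<in> I"
  shows "AE x in lborel_Pi I. x i \<noteq> c"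
proof (rule AE_I')
  have "emeasure (lborel_Pi I) (Pi\<^sub>E I (\<lambda>j. if j = i then {c} else UNIV)) = 0"
    using I i by (subst lborel_PiM.emeasure_PiM) (auto intro!: prod_zero bexI[of _ i])
  moreover have "Pi\<^sub>E I (\<lambda>j. if j = i then {c} else UNIV) \<in> sets (lborel_Pi I)"
    using I by (intro sets_PiM_I_finite) auto
  ultimately show "Pi\<^sub>E I (\<lambda>j. if j = i then {c} else UNIV) \<in> null_sets (lborel_Pi I)"
    by auto
  show "{x \<in> space (lborel_Pi I). \<not> x i \<noteq> c} \<subseteq> Pi\<^sub>E I (\<lambda>j. if j = i then {c} else UNIV)"
    using i by (auto simp: space_PiM PiE_iff extensional_def)
qed

section \<open>Averages over lower and upper sets\<close>

text \<open>The source of all dualities below: negating the signature reverses the order, and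
  equality in the zero coordinates is symmetric.\<close>

lemma sig_le_uminus:
  assumes "\<And>i. i \<in> I \<Longrightarrow> \<sigma> i \<in> {-1, 0, 1}"
  shows "sig_le I (\<lambda>i. - \<sigma> i) x y = sig_le I \<sigma> y x"
  using assms unfolding sig_le_def by fastforce

lemma integrable_continuous_on_rect:
  fixes g :: "(nat \<Rightarrow> real) \<Rightarrow> real"
  assumes I: "finite I" and g: "continuous_on (rect I a b) g"
  shows "integrable (lborel_Pi I) (\<lambda>x. indicator (rect I a b) x * g x)"
proof -
  have "bounded (g ` rect I a b)"
    using compact_continuous_image[OF g compact_rect] by (rule compact_imp_bounded)
  then obtain B where B: "\<And>x. x \<in> rect I a b \<Longrightarrow> \<bar>g x\<bar> \<le> B"
    unfolding bounded_iff by auto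
  have fin: "emeasure (lborel_Pi I) (rect I a b) < \<infinity>"
    unfolding rect_def using I by (subst lborel_PiM.emeasure_PiM)
      (auto simp: less_top[symmetric] ennreal_prod_eq_top emeasure_lborel_Icc_eq)
  show ?thesis
    by (rule integrableI_bounded_set[OF sets_rect[OF I] measurable_continuous_on_rect[OF I g] fin, of B])
       (auto simp: B indicator_def)
qed

lemma integrable_continuous_on_rect_indicator:
  fixes g :: "(nat \<Rightarrow> real) \<Rightarrow> real"
  assumes I: "finite I" and g: "continuous_on (rect I a b) g" and E: "E \<in> sets (lborel_Pi I)"
  shows "integrable (lborel_Pi I) (\<lambda>x. indicator (rect I a b) x * (indicator E x * g x))"
  using integrable_mult_indicator[OF E integrable_continuous_on_rect[OF I g]]
  by (simp add: mult.left_commute)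

lemma set_integral_lebesgue_PiM:
  fixes g :: "(nat \<Rightarrow> real) \<Rightarrow> real"
  assumes I: "finite I" and g: "continuous_on (rect I a b) g"
    and E: "E \<in> sets (lborel_Pi I)" "E \<subseteq> rect I a b"
  shows "(LINT x:E|lebesgue_PiM I. g x)
    = (\<integral>x. indicator (rect I a b) x * (indicator E x * g x) \<partial>lborel_Pi I)"
proof -
  have *: "(\<lambda>x. indicator E x *\<^sub>R g x) = (\<lambda>x. indicator (rect I a b) x * (indicator E x * g x))"
  proof
    fix x show "indicator E x *\<^sub>R g x = indicator (rect I a b) x * (indicator E x * g x)"
      using E(2) by (cases "x \<in> E") auto
  qed
  show ?thesis
    unfolding set_lebesgue_integral_def lebesgue_PiM_def *
    using integrable_continuous_on_rect_indicator[OF I g E(1)] by (intro integral_completion) auto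
qed

locale averages =
  fixes I :: "nat set" and a b :: "nat \<Rightarrow> real" and h v :: "(nat \<Rightarrow> real) \<Rightarrow> real" and M :: real
    and R :: "(nat \<Rightarrow> real) set"
  assumes I: "finite I" and ab: "\<And>i. i \<in> I \<Longrightarrow> a i < b i" and R: "R = rect I a b"
    and h: "continuous_on R h" "\<And>x. x \<in> R \<Longrightarrow> \<bar>h x\<bar> \<le> M"
    and v: "continuous_on R v" "\<And>x. x \<in> R \<Longrightarrow> 0 < v x"
begin

text \<open>Multiplying by the denominator turns a bound on an average into the sign of one
  integral, the form in which optimality of the grid projection can be used. The denominator is
  positive since a nonempty relatively open set has positive measure.\<close>

lemma Av_le:
  assumes E: "openin (top_of_set R) E" "x \<in> E"
    and le: "(\<integral>y. indicator R y * (indicator E y * ((h y - c) * v y)) \<partial>lborel_Pi I) \<le> 0"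
  shows "Av I h v E \<le> c"
proof -
  have Es: "E \<in> sets (lborel_Pi I)" "E \<subseteq> rect I a b" "0 < emeasure (lborel_Pi I) E"
    using sets_openin_rect[OF I] emeasure_openin_rect_pos[OF I ab] E openin_subset[OF E(1)] by (auto simp: R)
  have int: "integrable (lborel_Pi I) (\<lambda>y. indicator R y * (indicator E y * g y))"
    if "continuous_on R g" for g :: "_ \<Rightarrow> real"
    using integrable_continuous_on_rect_indicator[OF I _ Es(1)] that by (simp add: R)
  have iv: "integrable (lborel_Pi I) (\<lambda>y. indicator R y * (indicator E y * v y))"
    and ihv: "integrable (lborel_Pi I) (\<lambda>y. indicator R y * (indicator E y * (h y * v y)))"
    using h v by (auto intro!: int continuous_intros)
  define N D where "N = (\<integral>y. indicator R y * (indicator E y * (h y * v y)) \<partial>lborel_Pi I)"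
    and "D = (\<integral>y. indicator R y * (indicator E y * v y) \<partial>lborel_Pi I)"
  have "N - c * D = (\<integral>y. indicator R y * (indicator E y * (h y * v y))
      - c * (indicator R y * (indicator E y * v y)) \<partial>lborel_Pi I)"
    unfolding N_def D_def using iv ihv by simp
  also have "\<dots> = (\<integral>y. indicator R y * (indicator E y * ((h y - c) * v y)) \<partial>lborel_Pi I)"
    by (intro Bochner_Integration.integral_cong refl) (simp add: algebra_simps)
  finally have N: "N \<le> c * D" using le by simp
  have nn: "0 \<le> indicator R y * (indicator E y * v y)" for y
    using v(2)[of y] by (auto simp: indicator_def)
  have "D \<noteq> 0"
  proof
    assume "D = 0"
    then have "AE y in lborel_Pi I. indicator R y * (indicator E y * v y) = 0"
      unfolding D_def using iv nn by (subst (asm) integral_nonneg_eq_0_iff_AE) auto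
    then have "AE y in lborel_Pi I. y \<notin> E"
      by eventually_elim (use Es(2) v(2) R in \<open>force simp: indicator_def split: if_splits\<close>)
    then have "emeasure (lborel_Pi I) E = 0"
      using Es(1) by (subst (asm) AE_iff_measurable[of E]) (auto dest: sets.sets_into_space)
    then show False using Es(3) by simp
  qed
  moreover have "0 \<le> D" unfolding D_def using nn by (intro integral_nonneg_AE) auto
  moreover have "Av I h v E = N / D"
    unfolding Av_def N_def D_def R using h v Es
    by (subst (1 2) set_integral_lebesgue_PiM[OF I]) (auto intro!: continuous_intros simp: R)
  ultimately show ?thesis using N by (simp add: pos_divide_le_eq)
qed

lemma Av_le_bound:
  assumes "openin (top_of_set R) E" "x \<in> E"
  shows "Av I h v E \<le> M"
proof (rule Av_le[OF assms])
  have *: "0 \<le> - (indicator R y * (indicator E y * ((h y - M) * v y)))" for y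
    using h(2)[of y] v(2)[of y] by (cases "y \<in> R"; cases "y \<in> E") (auto simp: mult_le_0_iff)
  then have "0 \<le> (\<integral>y. - (indicator R y * (indicator E y * ((h y - M) * v y))) \<partial>lborel_Pi I)"
    by (intro integral_nonneg_AE) auto
  then show "(\<integral>y. indicator R y * (indicator E y * ((h y - M) * v y)) \<partial>lborel_Pi I) \<le> 0"
    by simp
qed

end

section \<open>Duality of averages under sign reversal\<close>

lemma Av_uminus: "Av I (\<lambda>y. - h y) v E = - Av I h v E"
  by (simp add: Av_def set_lebesgue_integral_def)

lemma averages_uminus: "averages I a b h v M R \<Longrightarrow> averages I a b (\<lambda>y. - h y) v M R"
  unfolding averages_def by (auto intro: continuous_on_minus)

lemma lower_ro_uminus:
  assumes "\<And>i. i \<in> I \<Longrightarrow> \<tau> i \<in> {-1, 0, 1}"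
  shows "lower_ro I (\<lambda>i. - \<tau> i) R x = upper_ro I \<tau> R x" "upper_ro I (\<lambda>i. - \<tau> i) R x = lower_ro I \<tau> R x"
proof -
  have s: "sig_le I (\<lambda>i. - \<tau> i) y z = sig_le I \<tau> z y" for y z
    using assms by (rule sig_le_uminus)
  show "lower_ro I (\<lambda>i. - \<tau> i) R x = upper_ro I \<tau> R x" "upper_ro I (\<lambda>i. - \<tau> i) R x = lower_ro I \<tau> R x"
    unfolding lower_ro_def upper_ro_def s by blast+
qed

lemma INF_real_uminus: "(INF x\<in>A. f x) = - (SUP x\<in>A. - f x :: real)"
  by (simp add: Inf_real_def image_image)

lemma SUP_real_uminus: "(SUP x\<in>A. f x) = - (INF x\<in>A. - f x :: real)"
  by (simp add: Inf_real_def image_image)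

text \<open>Negation interchanges infimum with supremum, and reversing the order interchanges lower
  with upper sets; so upper bounds for \<open>av_is\<close> yield lower bounds for
  \<open>av_si\<close>.\<close>

lemma av_si_uminus:
  assumes "\<And>i. i \<in> I \<Longrightarrow> \<tau> i \<in> {-1, 0, 1}"
  shows "av_si I \<tau> R v h x = - av_is I (\<lambda>i. - \<tau> i) R v (\<lambda>y. - h y) x"
proof -
  have "(INF L\<in>A. Av I h v (L \<inter> U)) = - (SUP L\<in>A. - Av I h v (U \<inter> L))" for A U
    by (subst INF_real_uminus) (simp add: Int_commute)
  moreover have "lower_ro I (\<lambda>i. - \<tau> i) R x = upper_ro I \<tau> R x"
    "upper_ro I (\<lambda>i. - \<tau> i) R x = lower_ro I \<tau> R x"
    using assms by (intro lower_ro_uminus; simp)+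
  ultimately show ?thesis
    unfolding av_si_def av_is_def Av_uminus by (subst SUP_real_uminus) simp
qed

context averages
begin

lemma lower_upper_ro:
  assumes "L \<in> lower_ro I \<tau> R x" "U \<in> upper_ro I \<tau> R x"
  shows "openin (top_of_set R) (L \<inter> U)" "x \<in> L \<inter> U"
  using assms by (auto simp: lower_ro_def upper_ro_def)

lemma Av_abs_le:
  assumes "L \<in> lower_ro I \<tau> R x" "U \<in> upper_ro I \<tau> R x"
  shows "\<bar>Av I h v (L \<inter> U)\<bar> \<le> M"
  using Av_le_bound[OF lower_upper_ro[OF assms]]
    averages.Av_le_bound[OF averages_uminus[OF averages_axioms] lower_upper_ro[OF assms]]
  by (simp add: Av_uminus)

text \<open>Makes both families nonempty, as infima and suprema in the conditionally complete reals
  require.\<close>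

lemma rect_lower_upper_ro: "x \<in> R \<Longrightarrow> R \<in> lower_ro I \<tau> R x" "x \<in> R \<Longrightarrow> R \<in> upper_ro I \<tau> R x"
  by (auto simp: lower_ro_def upper_ro_def)

lemma bdd_above_Av: "L \<in> lower_ro I \<tau> R x \<Longrightarrow> bdd_above ((\<lambda>U. Av I h v (L \<inter> U)) ` upper_ro I \<tau> R x)"
  using Av_abs_le[of L] by (intro bdd_aboveI2[of _ _ M]) (auto simp: abs_le_iff)

lemma bdd_below_Av: "U \<in> upper_ro I \<tau> R x \<Longrightarrow> bdd_below ((\<lambda>L. Av I h v (L \<inter> U)) ` lower_ro I \<tau> R x)"
  using Av_abs_le[of _ _ _ U] by (intro bdd_belowI2[of _ "-M"]) (auto simp: abs_le_iff minus_le_iff)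

lemma SUP_Av_ge:
  assumes "x \<in> R" "L \<in> lower_ro I \<tau> R x"
  shows "- M \<le> (SUP U\<in>upper_ro I \<tau> R x. Av I h v (L \<inter> U))"
  using Av_abs_le[OF assms(2) rect_lower_upper_ro(2)[OF assms(1)]]
  by (intro cSUP_upper2[OF bdd_above_Av[OF assms(2)] rect_lower_upper_ro(2)[OF assms(1)]])
     (auto simp: abs_le_iff)

lemma av_is_leI:
  assumes x: "x \<in> R" and L: "L \<in> lower_ro I \<tau> R x"
    and le: "\<And>U. U \<in> upper_ro I \<tau> R x \<Longrightarrow> Av I h v (L \<inter> U) \<le> c"
  shows "av_is I \<tau> R v h x \<le> c"
  unfolding av_is_def
proof (rule cINF_lower2[OF _ L])
  show "bdd_below ((\<lambda>L. SUP U\<in>upper_ro I \<tau> R x. Av I h v (L \<inter> U)) ` lower_ro I \<tau> R x)"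
    using SUP_Av_ge[OF x] by (intro bdd_belowI2[of _ "-M"])
  show "(SUP U\<in>upper_ro I \<tau> R x. Av I h v (L \<inter> U)) \<le> c"
    using rect_lower_upper_ro(2)[OF x] le by (intro cSUP_least) auto
qed

lemma av_is_le_bound: "x \<in> R \<Longrightarrow> av_is I \<tau> R v h x \<le> M"
  using Av_abs_le[OF rect_lower_upper_ro(1)]
  by (intro av_is_leI[OF _ rect_lower_upper_ro(1)]) (auto simp: abs_le_iff)

text \<open>The usual minimax inequality: both sides are compared with \<open>Av\<close> at one
  common pair \<open>L\<close>, \<open>U\<close>.\<close>

lemma av_si_le_av_is:
  assumes x: "x \<in> R"
  shows "av_si I \<tau> R v h x \<le> av_is I \<tau> R v h x"
  unfolding av_si_def av_is_def
proof (intro cSUP_least cINF_greatest)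
  fix U L assume UL: "U \<in> upper_ro I \<tau> R x" "L \<in> lower_ro I \<tau> R x"
  have "(INF L\<in>lower_ro I \<tau> R x. Av I h v (L \<inter> U)) \<le> Av I h v (L \<inter> U)"
    using UL by (intro cINF_lower bdd_below_Av)
  also have "\<dots> \<le> (SUP U\<in>upper_ro I \<tau> R x. Av I h v (L \<inter> U))"
    using UL by (intro cSUP_upper bdd_above_Av)
  finally show "(INF L\<in>lower_ro I \<tau> R x. Av I h v (L \<inter> U)) \<le> (SUP U\<in>upper_ro I \<tau> R x. Av I h v (L \<inter> U))" .
qed (use rect_lower_upper_ro[OF x] in auto)

end

section \<open>Grids\<close>

text \<open>The cap at \<open>n - 1\<close> puts the right endpoint \<open>u = n\<close> into the
  last cell.\<close>

definition cell_index :: "nat \<Rightarrow> real \<Rightarrow> nat" where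
  "cell_index n u = min (n - 1) (nat \<lfloor>u\<rfloor>)"

lemma cell_index_less: "0 < n \<Longrightarrow> cell_index n u < n"
  by (auto simp: cell_index_def)

lemma cell_index_bounds:
  assumes "0 < n" "0 \<le> u" "u \<le> real n"
  shows "real (cell_index n u) \<le> u" "u \<le> real (cell_index n u) + 1"
proof -
  have "real (nat \<lfloor>u\<rfloor>) \<le> u" "u < real (nat \<lfloor>u\<rfloor>) + 1" using assms by linarith+
  moreover have "real (cell_index n u) = min (real n - 1) (real (nat \<lfloor>u\<rfloor>))"
    using assms(1) by (simp add: cell_index_def of_nat_min of_nat_diff)
  ultimately show "real (cell_index n u) \<le> u" "u \<le> real (cell_index n u) + 1"
    using assms by linarith+
qed

lemma cell_index_mono: "u \<le> v \<Longrightarrow> cell_index n u \<le> cell_index n v"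
  unfolding cell_index_def by (intro min.mono nat_mono floor_mono) auto

lemma cell_index_near:
  assumes "0 < n" "0 \<le> u" "u \<le> real n" "0 \<le> v" "v \<le> real n" "\<bar>u - v\<bar> \<le> 1"
  shows "cell_index n u \<le> cell_index n v + 1"
proof -
  have "nat \<lfloor>u\<rfloor> \<le> nat \<lfloor>v\<rfloor> + 1" using assms by linarith
  then show ?thesis by (auto simp: cell_index_def)
qed

lemma cell_index_adjacent:
  assumes "j < n" "real j \<le> u" "u \<le> real j + 1"
  shows "j \<le> cell_index n u" "cell_index n u \<le> j + 1"
proof -
  have "j \<le> nat \<lfloor>u\<rfloor>" "nat \<lfloor>u\<rfloor> \<le> j + 1" using assms by linarith+
  then show "j \<le> cell_index n u" "cell_index n u \<le> j + 1"
    using assms by (auto simp: cell_index_def)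
qed

locale grid =
  fixes I :: "nat set" and a b :: "nat \<Rightarrow> real" and n :: nat
  assumes I: "finite I" and ab: "\<And>i. i \<in> I \<Longrightarrow> a i < b i" and n: "0 < n"
begin

definition len :: "nat \<Rightarrow> real" where "len i = (b i - a i) / n"
definition pt :: "(nat \<Rightarrow> nat) \<Rightarrow> nat \<Rightarrow> real" where "pt k = (\<lambda>i\<in>I. a i + real (k i) * len i)"
definition ix :: "(nat \<Rightarrow> nat) set" where "ix = (\<Pi>\<^sub>E i\<in>I. {..<n})"
text \<open>Closed cells cover the rectangle but share faces, open ones are disjoint and cover it
  only almost everywhere. Both are needed: the closed ones for topology, the open ones for
  integration.\<close>

definition cell :: "(nat \<Rightarrow> nat) \<Rightarrow> (nat \<Rightarrow> real) set" where
  "cell k = rect I (pt k) (\<lambda>i. pt k i + len i)"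
definition ocell :: "(nat \<Rightarrow> nat) \<Rightarrow> (nat \<Rightarrow> real) set" where
  "ocell k = (\<Pi>\<^sub>E i\<in>I. {pt k i<..<pt k i + len i})"
definition idx :: "(nat \<Rightarrow> real) \<Rightarrow> nat \<Rightarrow> nat" where
  "idx x = (\<lambda>i\<in>I. cell_index n ((x i - a i) / len i))"
text \<open>Adjacency of a chess king: diagonal neighbours and the cell itself count, since closed
  cells may meet in a corner only.\<close>

definition adj :: "(nat \<Rightarrow> nat) \<Rightarrow> (nat \<Rightarrow> nat) \<Rightarrow> bool" where
  "adj k l \<longleftrightarrow> (\<forall>i\<in>I. k i \<le> l i + 1 \<and> l i \<le> k i + 1)"

lemma finite_ix: "finite ix"
  unfolding ix_def using I by (intro finite_PiE) auto

lemma len_pos: "i \<in> I \<Longrightarrow> 0 < len i"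
  using ab n by (simp add: len_def)

lemma len_n: "i \<in> I \<Longrightarrow> real n * len i = b i - a i"
  using n by (simp add: len_def)

lemma coord_scaled:
  assumes "x \<in> rect I a b" "i \<in> I"
  shows "0 \<le> (x i - a i) / len i" "(x i - a i) / len i \<le> real n"
proof -
  have "a i \<le> x i" "x i \<le> b i" using assms by (auto simp: rect_def)
  then show "0 \<le> (x i - a i) / len i" "(x i - a i) / len i \<le> real n"
    using len_pos[OF assms(2)] len_n[OF assms(2)] by (auto simp: pos_divide_le_eq)
qed

lemma ix_bounds:
  assumes "k \<in> ix" "i \<in> I"
  shows "a i \<le> pt k i" "pt k i + len i \<le> b i"
proof -
  have "k i < n" using assms by (auto simp: ix_def)
  then have "real (k i) + 1 \<le> real n" by linarith
  then have "(real (k i) + 1) * len i \<le> real n * len i"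
    using len_pos[OF assms(2)] by (intro mult_right_mono) auto
  then show "a i \<le> pt k i" "pt k i + len i \<le> b i"
    using assms len_pos[OF assms(2)] len_n[OF assms(2)] by (auto simp: pt_def algebra_simps)
qed

lemma cell_subset: "k \<in> ix \<Longrightarrow> cell k \<subseteq> rect I a b"
  using ix_bounds[of k] unfolding cell_def rect_def by (intro PiE_mono) fastforce

lemma ocell_subset: "ocell k \<subseteq> cell k"
  unfolding cell_def ocell_def rect_def by (intro PiE_mono) auto

lemma pt_in_cell: "pt k \<in> cell k"
  using less_imp_le[OF len_pos] by (auto simp: cell_def rect_def pt_def)

lemma cell_iff:
  assumes "x \<in> extensional I"
  shows "x \<in> cell k \<longleftrightarrow> (\<forall>i\<in>I. real (k i) \<le> (x i - a i) / len i \<and> (x i - a i) / len i \<le> real (k i) + 1)"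
proof -
  have "pt k i \<le> x i \<and> x i \<le> pt k i + len i \<longleftrightarrow>
      real (k i) \<le> (x i - a i) / len i \<and> (x i - a i) / len i \<le> real (k i) + 1" if "i \<in> I" for i
    using len_pos[OF that] that by (simp add: pt_def field_simps)
  then show ?thesis using assms by (simp add: cell_def rect_def PiE_iff)
qed

lemma ocell_iff:
  assumes "x \<in> extensional I"
  shows "x \<in> ocell k \<longleftrightarrow> (\<forall>i\<in>I. real (k i) < (x i - a i) / len i \<and> (x i - a i) / len i < real (k i) + 1)"
proof -
  have "pt k i < x i \<and> x i < pt k i + len i \<longleftrightarrow>
      real (k i) < (x i - a i) / len i \<and> (x i - a i) / len i < real (k i) + 1" if "i \<in> I" for i
    using len_pos[OF that] that by (simp add: pt_def field_simps)
  then show ?thesis using assms by (simp add: ocell_def PiE_iff)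
qed

lemma idx_in_ix: "idx x \<in> ix"
  using n by (auto simp: idx_def ix_def cell_index_less)

lemma in_cell_idx: "x \<in> rect I a b \<Longrightarrow> x \<in> cell (idx x)"
  by (subst cell_iff)
     (auto simp: rect_extensional idx_def cell_index_bounds[OF n coord_scaled(1) coord_scaled(2)])

lemma ocell_unique:
  assumes "k \<in> ix" "l \<in> ix" "x \<in> ocell k" "x \<in> cell l"
  shows "l = k"
proof (rule PiE_ext)
  show "l \<in> (\<Pi>\<^sub>E i\<in>I. {..<n})" "k \<in> (\<Pi>\<^sub>E i\<in>I. {..<n})" using assms by (auto simp: ix_def)
  fix i assume i: "i \<in> I"
  have x: "x \<in> extensional I" using assms by (auto simp: cell_def rect_extensional)
  then show "l i = k i"
    using assms(3,4) i unfolding cell_iff[OF x] ocell_iff[OF x] by fastforce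
qed

lemma idx_ocell:
  assumes "k \<in> ix" "x \<in> ocell k"
  shows "idx x = k"
proof -
  have "x \<in> rect I a b" using assms ocell_subset[of k] cell_subset[of k] by auto
  then show ?thesis by (intro ocell_unique[OF assms(1) idx_in_ix assms(2)] in_cell_idx)
qed

lemma idx_cell_adj:
  assumes k: "k \<in> ix" and x: "x \<in> cell k"
  shows "adj (idx x) k"
  unfolding adj_def
proof
  fix i assume i: "i \<in> I"
  have "x \<in> extensional I" using x by (auto simp: cell_def rect_extensional)
  then have "real (k i) \<le> (x i - a i) / len i" "(x i - a i) / len i \<le> real (k i) + 1" "k i < n"
    using k x i by (auto simp: cell_iff ix_def)
  then show "idx x i \<le> k i + 1 \<and> k i \<le> idx x i + 1"
    using cell_index_adjacent[of "k i" n "(x i - a i) / len i"] i by (auto simp: idx_def)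
qed

lemma idx_adj:
  assumes "x \<in> rect I a b" "y \<in> rect I a b" "\<And>i. i \<in> I \<Longrightarrow> \<bar>x i - y i\<bar> \<le> len i"
  shows "adj (idx x) (idx y)"
  unfolding adj_def
proof
  fix i assume i: "i \<in> I"
  have "(x i - a i) / len i - (y i - a i) / len i = (x i - y i) / len i"
    by (simp add: diff_divide_distrib)
  also have "\<bar>\<dots>\<bar> \<le> 1" using assms(3)[OF i] len_pos[OF i] by simp
  finally show "idx x i \<le> idx y i + 1 \<and> idx y i \<le> idx x i + 1"
    using cell_index_near[OF n coord_scaled[OF assms(1) i] coord_scaled[OF assms(2) i]]
      cell_index_near[OF n coord_scaled[OF assms(2) i] coord_scaled[OF assms(1) i]] i
    by (simp add: idx_def abs_minus_commute)
qed

lemma idx_mono: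
  assumes "sig_le I \<sigma> x y"
  shows "sig_le I \<sigma> (real \<circ> idx x) (real \<circ> idx y)"
  unfolding sig_le_def
proof (intro ballI conjI impI)
  fix i assume i: "i \<in> I"
  note le = assms[unfolded sig_le_def, rule_format, OF i]
  show "(real \<circ> idx x) i = (real \<circ> idx y) i" if "\<sigma> i = 0"
    using le i that by (auto simp: idx_def)
  have m: "cell_index n ((u - a i) / len i) \<le> cell_index n ((v - a i) / len i)" if "u \<le> v" for u v
    using len_pos[OF i] that by (intro cell_index_mono divide_right_mono) auto
  show "of_int (\<sigma> i) * (real \<circ> idx x) i \<le> of_int (\<sigma> i) * (real \<circ> idx y) i" if "\<sigma> i \<in> {-1, 1}"
    using le i that m by (auto simp: idx_def)
qed

text \<open>On faces the selected index \<open>idx y\<close> can lie on the wrong side of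
  \<open>k\<close>: for \<open>\<sigma> i = -1\<close> and \<open>x = y\<close> on the upper face of
  cell \<open>k\<close>, it can exceed \<open>k i\<close>. So another cell containing
  \<open>y\<close> is selected, coordinate by coordinate.\<close>

lemma cell_mono:
  assumes k: "k \<in> ix" "x \<in> cell k" and y: "y \<in> rect I a b" and le: "sig_le I \<sigma> x y"
    and \<sigma>: "\<And>i. i \<in> I \<Longrightarrow> \<sigma> i \<in> {-1, 1}"
  shows "\<exists>l\<in>ix. y \<in> cell l \<and> sig_le I \<sigma> (real \<circ> k) (real \<circ> l)"
proof -
  have x: "x \<in> rect I a b" using k cell_subset by auto
  define u v where "u i = (x i - a i) / len i" and "v i = (y i - a i) / len i" for i
  \<comment> \<open>The coordinate of \<open>k\<close> is kept while \<open>y\<close> stays in that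
    closed slab; otherwise \<open>y\<close> has left it in the direction of
    \<open>\<sigma> i\<close>, and any slab containing \<open>y\<close> is on the right
    side.\<close>
  define l where "l = (\<lambda>i\<in>I. if real (k i) \<le> v i \<and> v i \<le> real (k i) + 1 then k i else cell_index n (v i))"
  have kb: "real (k i) \<le> u i" "u i \<le> real (k i) + 1" "k i < n" if "i \<in> I" for i
    using k that unfolding cell_iff[OF rect_extensional[OF x]] by (auto simp: u_def ix_def)
  have vb: "real (cell_index n (v i)) \<le> v i" "v i \<le> real (cell_index n (v i)) + 1" if "i \<in> I" for i
    unfolding v_def using cell_index_bounds[OF n coord_scaled[OF y that]] by auto
  have uv: "of_int (\<sigma> i) * u i \<le> of_int (\<sigma> i) * v i" if "i \<in> I" for i
  proof -
    have "of_int (\<sigma> i) * x i \<le> of_int (\<sigma> i) * y i" using le \<sigma>[OF that] that by (auto simp: sig_le_def)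
    then show ?thesis
      using \<sigma>[OF that] len_pos[OF that] by (auto simp: u_def v_def divide_right_mono)
  qed
  have "l \<in> ix" using kb(3) n by (auto simp: l_def ix_def cell_index_less)
  moreover have "y \<in> cell l"
    unfolding cell_iff[OF rect_extensional[OF y]] v_def[symmetric] using vb by (auto simp: l_def)
  moreover have "of_int (\<sigma> i) * real (k i) \<le> of_int (\<sigma> i) * real (l i)" if "i \<in> I" for i
  proof (cases "real (k i) \<le> v i \<and> v i \<le> real (k i) + 1")
    case False
    then show ?thesis
      using uv[OF that] kb[OF that] vb[OF that] \<sigma>[OF that] that by (auto simp: l_def)
  qed (use that in \<open>auto simp: l_def\<close>)
  ultimately show ?thesis using \<sigma> unfolding sig_le_def by fastforce
qed

lemma AE_ocell_idx: "AE x in lborel_Pi I. x \<in> rect I a b \<longrightarrow> x \<in> ocell (idx x)"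
proof -
  \<comment> \<open>All faces lie on finitely many null hyperplanes. Index \<open>n\<close> is
    included because the upper face of slab \<open>idx x i\<close> has number
    \<open>idx x i + 1\<close>.\<close>
  have "AE x in lborel_Pi I. \<forall>i\<in>I. \<forall>j\<in>{..n}. x i \<noteq> a i + real j * len i"
    using I by (intro AE_finite_allI AE_lborel_Pi_component_neq) auto
  then show ?thesis
  proof eventually_elim
    case (elim x)
    show ?case
    proof
      assume x: "x \<in> rect I a b"
      have b: "pt (idx x) i \<le> x i" "x i \<le> pt (idx x) i + len i" "idx x i < n" if "i \<in> I" for i
        using in_cell_idx[OF x] idx_in_ix[of x] that by (auto simp: cell_def rect_def ix_def)
      have "pt (idx x) i \<noteq> x i" "pt (idx x) i + len i \<noteq> x i" if "i \<in> I" for i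
        using elim that b(3)[OF that] bspec[OF bspec[OF elim that], of "idx x i"]
          bspec[OF bspec[OF elim that], of "Suc (idx x i)"] by (auto simp: pt_def algebra_simps)
      then show "x \<in> ocell (idx x)"
        using b x by (fastforce simp: ocell_def PiE_iff rect_def less_le)
    qed
  qed
qed

section \<open>Integration over the position inside a cell\<close>

definition base :: "(nat \<Rightarrow> real) set" where "base = (\<Pi>\<^sub>E i\<in>I. {0<..<len i})"
definition shift :: "(nat \<Rightarrow> nat) \<Rightarrow> (nat \<Rightarrow> real) \<Rightarrow> nat \<Rightarrow> real" where
  "shift k z = (\<lambda>i\<in>I. z i + pt k i)"

lemma shift_ocell: "z \<in> space (lborel_Pi I) \<Longrightarrow> shift k z \<in> ocell k \<longleftrightarrow> z \<in> base"
  by (auto simp: shift_def ocell_def base_def PiE_iff space_PiM)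

lemma measurable_shift: "shift k \<in> lborel_Pi I \<rightarrow>\<^sub>M lborel_Pi I"
  unfolding shift_def by (intro measurable_restrict) measurable

lemma distr_shift: "distr (lborel_Pi I) (lborel_Pi I) (shift k) = lborel_Pi I"
  unfolding shift_def by (rule distr_lborel_Pi_translate[OF I])

lemma sets_ocell: "ocell k \<in> sets (lborel_Pi I)"
  unfolding ocell_def using I by (intro sets_PiM_I_finite) auto

lemma AE_shift:
  assumes "AE x in lborel_Pi I. P x"
  shows "AE z in lborel_Pi I. P (shift k z)"
proof (rule AE_distrD[OF measurable_shift])
  show "AE x in distr (lborel_Pi I) (lborel_Pi I) (shift k). P x"
    unfolding distr_shift by (rule assms)
qed

text \<open>All open cells are translates of \<open>base\<close>, so the integral over the rectangle
  is the integral, over the offset \<open>z\<close>, of the finite sums over the points with that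
  offset. Discrete optimality controls just these sums, for each \<open>z\<close>
  separately.\<close>

lemma integral_rect_nonpos:
  fixes F :: "(nat \<Rightarrow> real) \<Rightarrow> real"
  assumes F: "integrable (lborel_Pi I) (\<lambda>x. indicator (rect I a b) x * F x)"
    and le: "AE z in lborel_Pi I. z \<in> base \<longrightarrow> (\<Sum>k\<in>ix. F (shift k z)) \<le> 0"
  shows "(\<integral>x. indicator (rect I a b) x * F x \<partial>lborel_Pi I) \<le> 0"
proof -
  define G where "G = (\<lambda>x. indicator (rect I a b) x * F x)"
  have Gm: "G \<in> borel_measurable (lborel_Pi I)" using F by (auto simp: G_def)
  have ind: "indicator (ocell k) x * G x = indicator (ocell k) x * F x" if "k \<in> ix" for k x
    using cell_subset[OF that] ocell_subset[of k] by (auto simp: G_def indicator_def)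
  have indb: "indicator (ocell k) (shift k z) * G (shift k z) = indicator base z * F (shift k z)"
    if "k \<in> ix" "z \<in> space (lborel_Pi I)" for k z
    unfolding ind[OF that(1)] using shift_ocell[OF that(2), of k] by (simp add: indicator_def)
  have int: "integrable (lborel_Pi I) (\<lambda>x. indicator (ocell k) x * G x)" for k
    using integrable_mult_indicator[OF sets_ocell, of G k] F by (simp add: G_def)
  have "(\<integral>x. G x \<partial>lborel_Pi I) = (\<integral>x. (\<Sum>k\<in>ix. indicator (ocell k) x * G x) \<partial>lborel_Pi I)"
  proof (rule integral_cong_AE)
    show "AE x in lborel_Pi I. G x = (\<Sum>k\<in>ix. indicator (ocell k) x * G x)"
      using AE_ocell_idx
    proof eventually_elim
      case (elim x)
      have "(\<Sum>k\<in>ix. indicator (ocell k) x * G x) = (\<Sum>k\<in>ix. if k = idx x then G x else 0)"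
      proof (intro sum.cong refl)
        fix k assume k: "k \<in> ix"
        show "indicator (ocell k) x * G x = (if k = idx x then G x else 0)"
        proof (cases "x \<in> ocell k")
          case True
          then show ?thesis using idx_ocell[OF k] by simp
        next
          case False
          then have "k \<noteq> idx x \<or> x \<notin> rect I a b" using elim by blast
          then have "k \<noteq> idx x \<or> G x = 0" by (auto simp: G_def)
          then show ?thesis using False by auto
        qed
      qed
      then show ?case using finite_ix idx_in_ix by simp
    qed
    show "(\<lambda>x. \<Sum>k\<in>ix. indicator (ocell k) x * G x) \<in> borel_measurable (lborel_Pi I)"
      using int by (intro borel_measurable_sum) auto
  qed (fact Gm)
  also have "\<dots> = (\<Sum>k\<in>ix. \<integral>x. indicator (ocell k) x * G x \<partial>lborel_Pi I)"
    using int by (rule Bochner_Integration.integral_sum)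
  also have "\<dots> = (\<Sum>k\<in>ix. \<integral>z. indicator base z * F (shift k z) \<partial>lborel_Pi I)"
  proof (intro sum.cong refl)
    fix k assume k: "k \<in> ix"
    have "(\<integral>x. indicator (ocell k) x * G x \<partial>lborel_Pi I)
        = (\<integral>x. indicator (ocell k) x * G x \<partial>distr (lborel_Pi I) (lborel_Pi I) (shift k))"
      by (simp add: distr_shift)
    also have "\<dots> = (\<integral>z. indicator (ocell k) (shift k z) * G (shift k z) \<partial>lborel_Pi I)"
      using int by (intro integral_distr measurable_shift) auto
    also have "\<dots> = (\<integral>z. indicator base z * F (shift k z) \<partial>lborel_Pi I)"
      by (intro Bochner_Integration.integral_cong refl indb k)
    finally show "(\<integral>x. indicator (ocell k) x * G x \<partial>lborel_Pi I) = \<dots>" .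
  qed
  also have "\<dots> = (\<integral>z. (\<Sum>k\<in>ix. indicator base z * F (shift k z)) \<partial>lborel_Pi I)"
  proof (rule Bochner_Integration.integral_sum[symmetric])
    fix k assume k: "k \<in> ix"
    have "integrable (distr (lborel_Pi I) (lborel_Pi I) (shift k)) (\<lambda>x. indicator (ocell k) x * G x)"
      using int by (simp add: distr_shift)
    from integrable_distr[OF measurable_shift this]
    show "integrable (lborel_Pi I) (\<lambda>z. indicator base z * F (shift k z))"
      by (rule Bochner_Integration.integrable_cong[THEN iffD1, rotated 2]) (auto simp: indb[OF k])
  qed
  also have "\<dots> \<le> 0"
  proof -
    have "0 \<le> (\<integral>z. - (\<Sum>k\<in>ix. indicator base z * F (shift k z)) \<partial>lborel_Pi I)"
    proof (rule integral_nonneg_AE)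
      show "AE z in lborel_Pi I. 0 \<le> - (\<Sum>k\<in>ix. indicator base z * F (shift k z))"
        using le by eventually_elim (auto simp: sum_distrib_left[symmetric] indicator_def)
    qed
    then show ?thesis by simp
  qed
  finally show ?thesis by (simp add: G_def)
qed

end

section \<open>Isotonic regression on a grid\<close>

text \<open>With \<open>\<phi>\<close> a translation stopped at the border, this is the order
  preservation demanded of \<open>S\<close> and \<open>S'\<close> in
  \<open>isotonic_proj_jump\<close>; coordinates with signature \<open>0\<close> make no
  exception.\<close>

lemma sig_le_fun_upd:
  assumes "sig_le I \<sigma> (real \<circ> k) (real \<circ> l)" "mono \<phi>"
  shows "sig_le I \<sigma> (real \<circ> k(i := \<phi> (k i))) (real \<circ> l(i := \<phi> (l i)))"
  unfolding sig_le_def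
proof (rule ballI)
  fix j assume j: "j \<in> I"
  have le: "\<sigma> j \<in> {-1, 1} \<longrightarrow> of_int (\<sigma> j) * real (k j) \<le> of_int (\<sigma> j) * real (l j)"
    "\<sigma> j = 0 \<longrightarrow> k j = l j"
    using assms(1) j by (auto simp: sig_le_def)
  have "k j \<le> l j \<longrightarrow> \<phi> (k j) \<le> \<phi> (l j)" "l j \<le> k j \<longrightarrow> \<phi> (l j) \<le> \<phi> (k j)"
    using assms(2) by (auto dest: monoD)
  then show "(\<sigma> j \<in> {-1, 1} \<longrightarrow> of_int (\<sigma> j) * (real \<circ> k(i := \<phi> (k i))) j
        \<le> of_int (\<sigma> j) * (real \<circ> l(i := \<phi> (l i))) j) \<and>
      (\<sigma> j = 0 \<longrightarrow> (real \<circ> k(i := \<phi> (k i))) j = (real \<circ> l(i := \<phi> (l i))) j)"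
    using le by (cases "j = i") auto
qed

context grid
begin

lemma pt_adj:
  assumes "adj k l" "i \<in> I"
  shows "\<bar>pt k i - pt l i\<bar> \<le> len i"
proof -
  have "\<bar>pt k i - pt l i\<bar> = \<bar>real (k i) - real (l i)\<bar> * len i"
    using assms(2) len_pos[OF assms(2)] by (simp add: pt_def abs_mult left_diff_distrib[symmetric])
  also have "\<bar>real (k i) - real (l i)\<bar> \<le> 1"
    using assms by (auto simp: adj_def)
  finally show ?thesis using len_pos[OF assms(2)] by (simp add: mult_right_mono)
qed

lemma cell_pt: "x \<in> cell k \<Longrightarrow> i \<in> I \<Longrightarrow> \<bar>x i - pt k i\<bar> \<le> len i"
  by (auto simp: cell_def rect_def PiE_iff abs_le_iff)

lemma pt_in_rect: "k \<in> ix \<Longrightarrow> pt k \<in> rect I a b"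
  using cell_subset pt_in_cell by blast

text \<open>Points with equal offset inherit the order of their cells, so a monotone function or an
  upper set, sampled at a fixed offset, gives a monotone function on the grid.\<close>

lemma shift_mono:
  assumes "sig_le I \<sigma> (real \<circ> k) (real \<circ> l)"
  shows "sig_le I \<sigma> (shift k z) (shift l z)"
  unfolding sig_le_def
proof (intro ballI conjI impI)
  fix i assume i: "i \<in> I"
  note le = bspec[OF assms[unfolded sig_le_def] i]
  show "shift k z i = shift l z i" if "\<sigma> i = 0"
    using le i that by (simp add: shift_def pt_def)
  show "of_int (\<sigma> i) * shift k z i \<le> of_int (\<sigma> i) * shift l z i" if "\<sigma> i \<in> {-1, 1}"
  proof -
    have "of_int (\<sigma> i) * real (k i) * len i \<le> of_int (\<sigma> i) * real (l i) * len i"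
      using le that len_pos[OF i] by (intro mult_right_mono) auto
    then show ?thesis using i by (simp add: shift_def pt_def algebra_simps)
  qed
qed

end

locale grid_proj = grid I a b n for I a b n +
  fixes \<sigma> :: "nat \<Rightarrow> int" and f w :: "(nat \<Rightarrow> real) \<Rightarrow> real" and p :: "(nat \<Rightarrow> nat) \<Rightarrow> real"
    and M m \<omega> :: real
  assumes \<sigma>: "\<And>i. i \<in> I \<Longrightarrow> \<sigma> i \<in> {-1, 0, 1}"
    and f: "continuous_on (rect I a b) f" "\<And>x. x \<in> rect I a b \<Longrightarrow> \<bar>f x\<bar> \<le> M"
    and w: "continuous_on (rect I a b) w" "\<And>x. x \<in> rect I a b \<Longrightarrow> m \<le> w x"
    and m: "0 < m"
    and osc: "\<And>x y. x \<in> rect I a b \<Longrightarrow> y \<in> rect I a b \<Longrightarrow> (\<And>i. i \<in> I \<Longrightarrow> \<bar>x i - y i\<bar> \<le> (b i - a i) / n) \<Longrightarrow>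
      \<bar>f x - f y\<bar> \<le> \<omega> \<and> \<bar>w x - w y\<bar> \<le> \<omega>"
    and p: "isotonic_proj (grid.ix I n) (\<lambda>k l. sig_le I \<sigma> (real \<circ> k) (real \<circ> l))
      (w \<circ> grid.pt I a b n) (f \<circ> grid.pt I a b n) p"
begin

text \<open>The threshold shift from \<open>weighted_residual_le\<close>: it bounds a single jump of
  \<open>p\<close> and is the price for exchanging a point of a cell with its corner.\<close>

definition J :: real where "J = \<omega> + 2 * M * \<omega> / m"

lemma w_pt_pos: "k \<in> ix \<Longrightarrow> 0 < (w \<circ> pt) k"
  using w(2)[OF pt_in_rect] m by fastforce

lemma p_abs_le: "k \<in> ix \<Longrightarrow> \<bar>p k\<bar> \<le> M"
  using isotonic_proj_abs_le[OF finite_ix p w_pt_pos] f(2)[OF pt_in_rect] by auto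

lemma p_mono: "k \<in> ix \<Longrightarrow> l \<in> ix \<Longrightarrow> sig_le I \<sigma> (real \<circ> k) (real \<circ> l) \<Longrightarrow> p k \<le> p l"
  using p by (auto simp: isotonic_proj_def monotone_on_def)

lemma osc_cell:
  assumes "k \<in> ix" "x \<in> cell k"
  shows "\<bar>f x - f (pt k)\<bar> \<le> \<omega>" "\<bar>w x - w (pt k)\<bar> \<le> \<omega>"
  using osc[of x "pt k"] cell_subset[OF assms(1)] assms cell_pt[OF assms(2)] pt_in_rect
  by (auto simp: len_def)

lemma osc_adj:
  assumes "k \<in> ix" "l \<in> ix" "adj k l"
  shows "\<bar>f (pt k) - f (pt l)\<bar> \<le> \<omega>" "\<bar>w (pt k) - w (pt l)\<bar> \<le> \<omega>"
  using osc[of "pt k" "pt l"] pt_in_rect pt_adj[OF assms(3)] assms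
  by (auto simp: len_def)

lemma nonneg: "0 \<le> M" "0 \<le> \<omega>" "0 \<le> J"
proof -
  have x: "idx a \<in> ix" by (rule idx_in_ix)
  show "0 \<le> M" "0 \<le> \<omega>"
    using p_abs_le[OF x] osc_cell[OF x pt_in_cell] by auto
  then show "0 \<le> J" using m by (simp add: J_def)
qed

text \<open>\<open>\<phi>\<close> and \<open>\<psi>\<close> stand for opposite translations of one
  coordinate, each stopping at the border; the alternatives in \<open>inv\<close> cover the border
  cells.\<close>

lemma p_jump:
  assumes "k \<in> ix" "i \<in> I" "mono \<phi>" "mono \<psi>"
    and less: "\<And>j. j < n \<Longrightarrow> \<phi> j < n" "\<And>j. j < n \<Longrightarrow> \<psi> j < n"
    and inv: "\<And>j. j < n \<Longrightarrow> \<phi> j = j \<or> \<psi> (\<phi> j) = j" "\<And>j. j < n \<Longrightarrow> \<psi> j = j \<or> \<phi> (\<psi> j) = j"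
    and adj: "\<And>j. \<phi> j \<le> j + 1" "\<And>j. j < n \<Longrightarrow> j \<le> \<phi> j + 1"
  shows "p k - p (k(i := \<phi> (k i))) \<le> J"
  unfolding J_def
proof (rule isotonic_proj_jump[OF finite_ix p m, where S = "\<lambda>k. k(i := \<phi> (k i))" and S' = "\<lambda>k. k(i := \<psi> (k i))"])
  show "m \<le> (w \<circ> pt) k" "\<bar>(f \<circ> pt) k\<bar> \<le> M" if "k \<in> ix" for k
    using w(2) f(2) pt_in_rect[OF that] by auto
  have upd: "k(i := c) \<in> ix" if "k \<in> ix" "c < n" for k c
    using that assms(2) by (auto simp: ix_def PiE_iff extensional_def)
  have lt: "k i < n" if "k \<in> ix" for k using that assms(2) by (auto simp: ix_def)
  show "(\<lambda>k. k(i := \<phi> (k i))) \<in> ix \<rightarrow> ix" "(\<lambda>k. k(i := \<psi> (k i))) \<in> ix \<rightarrow> ix"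
    using upd lt less by auto
  show "k(i := \<phi> (k i)) = k \<or> (k(i := \<phi> (k i)))(i := \<psi> ((k(i := \<phi> (k i))) i)) = k"
    "k(i := \<psi> (k i)) = k \<or> (k(i := \<psi> (k i)))(i := \<phi> ((k(i := \<psi> (k i))) i)) = k" if "k \<in> ix" for k
    using inv[OF lt[OF that]] by (auto simp: fun_eq_iff)
  show "\<bar>(f \<circ> pt) k - (f \<circ> pt) (k(i := \<phi> (k i)))\<bar> \<le> \<omega>"
    "\<bar>(w \<circ> pt) k - (w \<circ> pt) (k(i := \<phi> (k i)))\<bar> \<le> \<omega>" if "k \<in> ix" for k
  proof -
    have "grid.adj I k (k(i := \<phi> (k i)))"
      using adj(1) adj(2)[OF lt[OF that]] by (auto simp: adj_def)
    then show "\<bar>(f \<circ> pt) k - (f \<circ> pt) (k(i := \<phi> (k i)))\<bar> \<le> \<omega>"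
      "\<bar>(w \<circ> pt) k - (w \<circ> pt) (k(i := \<phi> (k i)))\<bar> \<le> \<omega>"
      using osc_adj[OF that upd[OF that less(1)[OF lt[OF that]]]] by auto
  qed
qed (use assms in \<open>auto intro!: sig_le_fun_upd\<close>)

lemma p_step:
  assumes k: "k \<in> ix" and i: "i \<in> I" and c: "c < n" "c \<le> k i + 1" "k i \<le> c + 1"
  shows "p k - p (k(i := c)) \<le> J"
proof -
  \<comment> \<open>Truncated subtraction stops at \<open>0\<close>, the minimum stops at
    \<open>n - 1\<close>; exchanging the roles of the two maps gives the step in the other
    direction.\<close>
  have inv: "mono (\<lambda>j::nat. j - 1)" "mono (\<lambda>j. min (j + 1) (n - 1))"
    by (auto intro!: monoI)
  consider "c = k i" | "c = k i - 1" | "c = min (k i + 1) (n - 1)"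
    using c by linarith
  then show ?thesis
  proof cases
    case 1
    then show ?thesis using nonneg by simp
  next
    case 2
    have "p k - p (k(i := k i - 1)) \<le> J"
      by (rule p_jump[OF k i inv]) auto
    then show ?thesis by (simp only: 2)
  next
    case 3
    have "p k - p (k(i := min (k i + 1) (n - 1))) \<le> J"
      by (rule p_jump[OF k i inv(2,1)]) auto
    then show ?thesis by (simp only: 3)
  qed
qed

text \<open>Replacing the coordinates of \<open>k\<close> by those of \<open>l\<close> one at a time
  stays in the grid and takes \<open>card I\<close> steps, each costing at most
  \<open>J\<close>.\<close>

lemma p_adj:
  assumes k: "k \<in> ix" and l: "l \<in> ix" and adj: "adj k l"
  shows "p k - p l \<le> card I * J"
proof -
  have "p k - p (\<lambda>i. if i \<in> A then l i else k i) \<le> card A * J" if "A \<subseteq> I" "finite A" for A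
    using that(2,1)
  proof (induction A rule: finite_induct)
    case (insert i A)
    define k' where "k' = (\<lambda>i. if i \<in> A then l i else k i)"
    have k': "k' \<in> ix" using k l insert.prems by (auto simp: k'_def ix_def PiE_iff extensional_def)
    have "p k' - p (k'(i := l i)) \<le> J"
      using insert adj l by (intro p_step k') (auto simp: k'_def adj_def ix_def)
    moreover have "k'(i := l i) = (\<lambda>j. if j \<in> insert i A then l j else k j)"
      by (auto simp: k'_def fun_eq_iff)
    ultimately have "p k' - p (\<lambda>j. if j \<in> insert i A then l j else k j) \<le> J" by simp
    then show ?case using insert by (simp add: k'_def algebra_simps)
  qed simp
  from this[OF subset_refl I] have "p k - p (\<lambda>i. if i \<in> I then l i else k i) \<le> card I * J" .
  also have "(\<lambda>i. if i \<in> I then l i else k i) = l"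
    using k l by (auto simp: ix_def PiE_iff extensional_def fun_eq_iff)
  finally show ?thesis .
qed

lemma uminus: "grid_proj I a b n (\<lambda>i. - \<sigma> i) (\<lambda>x. - f x) w (\<lambda>k. - p k) M m \<omega>"
proof
  have "(\<lambda>k l. sig_le I (\<lambda>i. - \<sigma> i) (real \<circ> k) (real \<circ> l)) = (\<lambda>k l. sig_le I \<sigma> (real \<circ> l) (real \<circ> k))"
    using \<sigma> by (intro ext sig_le_uminus) auto
  then show "isotonic_proj (grid.ix I n) (\<lambda>k l. sig_le I (\<lambda>i. - \<sigma> i) (real \<circ> k) (real \<circ> l))
      (w \<circ> grid.pt I a b n) ((\<lambda>x. - f x) \<circ> grid.pt I a b n) (\<lambda>k. - p k)"
    using isotonic_proj_uminus[OF p] by (simp add: comp_def)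
  show "\<bar>- f x - - f y\<bar> \<le> \<omega> \<and> \<bar>w x - w y\<bar> \<le> \<omega>"
    if "x \<in> rect I a b" "y \<in> rect I a b" "\<And>i. i \<in> I \<Longrightarrow> \<bar>x i - y i\<bar> \<le> (b i - a i) / n" for x y
    using osc[OF that] by (auto simp: abs_minus_commute)
qed (use \<sigma> f w m in \<open>auto intro: continuous_on_minus\<close>)

end

section \<open>Separating the coordinates with signature zero\<close>

lemma hat_dot_coords:
  assumes "\<And>i. i \<in> I \<Longrightarrow> \<sigma> i \<in> {-1, 0, 1}"
  shows "hat_coords I \<sigma> \<union> dot_coords I \<sigma> = I" "hat_coords I \<sigma> \<inter> dot_coords I \<sigma> = {}"
  using assms by (force simp: hat_coords_def dot_coords_def)+

lemma continuous_on_merge: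
  "continuous_on S (\<lambda>y. merge A B (y, c) :: nat \<Rightarrow> real)"
proof (rule continuous_on_coordinatewise_then_product)
  fix i
  show "continuous_on S (\<lambda>y. merge A B (y, c) i)"
  proof (cases "i \<in> A")
    case True
    then show ?thesis
      by (simp add: merge_def) (rule continuous_on_subset[OF continuous_on_product_coordinates], simp)
  qed (simp add: merge_def)
qed

lemma merge_in_rect:
  assumes "\<And>i. i \<in> I \<Longrightarrow> \<sigma> i \<in> {-1, 0, 1}" "x \<in> rect I a b" "y \<in> rect (hat_coords I \<sigma>) a b"
  shows "merge (hat_coords I \<sigma>) (dot_coords I \<sigma>) (y, restrict x (dot_coords I \<sigma>)) \<in> rect I a b"
  using assms(2,3) hat_dot_coords[of I \<sigma>, OF assms(1)]
  unfolding rect_def by (auto simp: merge_def PiE_iff extensional_def)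

lemma continuous_on_slice:
  fixes f :: "(nat \<Rightarrow> real) \<Rightarrow> real"
  assumes "\<And>i. i \<in> I \<Longrightarrow> \<sigma> i \<in> {-1, 0, 1}" "x \<in> rect I a b" "continuous_on (rect I a b) f"
  shows "continuous_on (rect (hat_coords I \<sigma>) a b) (slice I \<sigma> f x)"
  unfolding slice_def
  by (rule continuous_on_compose2[OF assms(3) continuous_on_merge])
     (use merge_in_rect[of I \<sigma>, OF assms(1,2)] in auto)

text \<open>With the same \<open>n\<close>, \<open>a\<close> and \<open>b\<close>, the cells of this
  smaller grid are exactly the factors of the full cells.\<close>

sublocale grid_proj \<subseteq> hat: grid "hat_coords I \<sigma>" a b n
  using I ab n by unfold_locales (auto simp: hat_coords_def)

context grid_proj
begin

abbreviation "H \<equiv> hat_coords I \<sigma>"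
abbreviation "D \<equiv> dot_coords I \<sigma>"

lemma HD: "H \<union> D = I" "H \<inter> D = {}"
  using hat_dot_coords[of I \<sigma>] \<sigma> by auto

lemma \<sigma>_H: "i \<in> H \<Longrightarrow> \<sigma> i \<in> {-1, 1}" and \<sigma>_D: "i \<in> D \<Longrightarrow> \<sigma> i = 0"
  by (auto simp: hat_coords_def dot_coords_def)

lemma averages_slice:
  assumes "x \<in> rect I a b"
  shows "averages H a b (slice I \<sigma> f x) (slice I \<sigma> w x) M (rect H a b)"
proof
  show "continuous_on (rect H a b) (slice I \<sigma> f x)" "continuous_on (rect H a b) (slice I \<sigma> w x)"
    by (intro continuous_on_slice[OF _ assms] f(1) w(1); use \<sigma> in simp)+
  fix y assume "y \<in> rect H a b"
  then have y: "merge H D (y, restrict x D) \<in> rect I a b"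
    by (intro merge_in_rect assms) (use \<sigma> in auto)
  show "\<bar>slice I \<sigma> f x y\<bar> \<le> M" "0 < slice I \<sigma> w x y"
    using f(2)[OF y] w(2)[OF y] m by (auto simp: slice_def)
qed (use hat.I hat.ab in auto)

text \<open>Runs through one fibre of the grid; the values of \<open>p\<close> on this fibre model
  the slice through \<open>x\<close>.\<close>

definition lift_ix :: "(nat \<Rightarrow> real) \<Rightarrow> (nat \<Rightarrow> nat) \<Rightarrow> nat \<Rightarrow> nat" where
  "lift_ix x j = merge H D (j, restrict (idx x) D)"

lemma lift_ix_simps [simp]:
  "i \<in> H \<Longrightarrow> lift_ix x j i = j i" "i \<in> D \<Longrightarrow> lift_ix x j i = idx x i"
  using HD(2) by (auto simp: lift_ix_def merge_def)

lemma lift_ix_in_ix: "j \<in> hat.ix \<Longrightarrow> lift_ix x j \<in> ix"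
  using idx_in_ix[of x] HD unfolding lift_ix_def ix_def hat.ix_def
  by (auto simp: merge_def PiE_iff extensional_def)

lemma merge_in_cell:
  assumes x: "x \<in> rect I a b" and j: "y \<in> hat.cell j"
  shows "merge H D (y, restrict x D) \<in> cell (lift_ix x j)"
proof -
  have *: "i \<in> I \<Longrightarrow> i \<in> H \<or> i \<in> D" for i using HD by auto
  have "pt (lift_ix x j) i \<le> merge H D (y, restrict x D) i \<and>
      merge H D (y, restrict x D) i \<le> pt (lift_ix x j) i + len i" if i: "i \<in> I" for i
  proof (cases "i \<in> H")
    case True
    then have "hat.pt j i \<le> y i" "y i \<le> hat.pt j i + len i"
      using j by (auto simp: hat.cell_def rect_def)
    then show ?thesis using True i by (simp add: pt_def hat.pt_def merge_def)
  next
    case False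
    then have D: "i \<in> D" using i * by auto
    have "pt (idx x) i \<le> x i" "x i \<le> pt (idx x) i + len i"
      using in_cell_idx[OF x] i by (auto simp: cell_def rect_def)
    then show ?thesis using D False i by (simp add: pt_def merge_def)
  qed
  moreover have "merge H D (y, restrict x D) \<in> extensional I"
    using HD by (auto simp: merge_def extensional_def)
  ultimately show ?thesis by (simp add: cell_def rect_def PiE_iff)
qed

lemma slice_residual_le:
  assumes x: "x \<in> rect I a b" and j: "j \<in> hat.ix" "y \<in> hat.cell j" and t: "\<bar>t\<bar> \<le> M"
  shows "(slice I \<sigma> f x y - (t + J)) * slice I \<sigma> w x y
    \<le> (f (pt (lift_ix x j)) - t) * w (pt (lift_ix x j))"
proof -
  define Y where "Y = merge H D (y, restrict x D)"
  define k where "k = lift_ix x j"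
  have k: "k \<in> ix" "Y \<in> cell k" using lift_ix_in_ix[OF j(1)] merge_in_cell[OF x j(2)] by (auto simp: k_def Y_def)
  have Y: "Y \<in> rect I a b" using k cell_subset by auto
  \<comment> \<open>Negated values with the corner as source: the slack \<open>J\<close> then sits
    at the point \<open>Y\<close>, where it becomes the raised threshold
    \<open>t + J\<close>.\<close>
  have "((- f (pt k)) - (- t)) * w (pt k) \<le> ((- f Y) - (- t) + J) * w Y"
    unfolding J_def using osc_cell[OF k] f(2)[OF pt_in_rect[OF k(1)]] t m w(2)[OF Y]
    by (intro weighted_residual_le) (auto simp: abs_minus_commute)
  then show ?thesis by (simp add: slice_def Y_def k_def algebra_simps)
qed

text \<open>Comparable indices agree in the zero coordinates, so different fibres are unrelated. A
  monotone test function on the fibre of \<open>x\<close>, extended by zero, is therefore monotone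
  on the whole grid, and the inequality for \<open>p\<close> holds fibre by fibre.\<close>

lemma sum_slice_nonpos:
  assumes x: "x \<in> rect I a b"
    and g: "\<And>j. j \<in> hat.ix \<Longrightarrow> 0 \<le> g j"
      "\<And>j l. j \<in> hat.ix \<Longrightarrow> l \<in> hat.ix \<Longrightarrow> sig_le H \<sigma> (real \<circ> j) (real \<circ> l) \<Longrightarrow> g j \<le> g l"
  shows "(\<Sum>j\<in>{j\<in>hat.ix. p (lift_ix x j) < t}.
    (f (pt (lift_ix x j)) - t) * w (pt (lift_ix x j)) * g j) \<le> 0"
proof -
  define G where "G k = (if restrict k D = restrict (idx x) D then g (restrict k H) else 0)" for k
  have res: "restrict k H \<in> hat.ix" if "k \<in> ix" for k
    using that HD by (auto simp: ix_def hat.ix_def)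
  have lift: "restrict (lift_ix x j) H = j" "restrict (lift_ix x j) D = restrict (idx x) D"
    if "j \<in> hat.ix" for j
    using that by (auto simp: hat.ix_def PiE_iff extensional_def fun_eq_iff)
  have "(\<Sum>k\<in>{k\<in>ix. p k < t}. ((f \<circ> pt) k - t) * (w \<circ> pt) k * G k) \<le> 0"
  proof (rule isotonic_proj_upper'[OF finite_ix p w_pt_pos])
    show "0 \<le> G k" if "k \<in> ix" for k using g(1) res[OF that] by (auto simp: G_def)
    show "monotone_on ix (\<lambda>k l. sig_le I \<sigma> (real \<circ> k) (real \<circ> l)) (\<le>) G"
    proof (rule monotone_onI)
      fix k l assume kl: "k \<in> ix" "l \<in> ix" "sig_le I \<sigma> (real \<circ> k) (real \<circ> l)"
      have "k i = l i" if "i \<in> D" for i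
        using kl(3) that HD(1) \<sigma>_D[OF that] by (auto simp: sig_le_def)
      then have eq: "restrict k D = restrict l D" by (auto simp: fun_eq_iff)
      have "sig_le H \<sigma> (real \<circ> restrict k H) (real \<circ> restrict l H)"
        using kl(3) HD(1) by (auto simp: sig_le_def)
      then have "g (restrict k H) \<le> g (restrict l H)" by (intro g(2) res kl)
      then show "G k \<le> G l" using eq by (simp add: G_def)
    qed
  qed auto
  also have "(\<Sum>k\<in>{k\<in>ix. p k < t}. ((f \<circ> pt) k - t) * (w \<circ> pt) k * G k)
      = (\<Sum>k\<in>lift_ix x ` {j\<in>hat.ix. p (lift_ix x j) < t}. (f (pt k) - t) * w (pt k) * G k)"
  proof (rule sum.mono_neutral_cong_right)
    show "\<forall>k\<in>{k\<in>ix. p k < t} - lift_ix x ` {j\<in>hat.ix. p (lift_ix x j) < t}.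
      ((f \<circ> pt) k - t) * (w \<circ> pt) k * G k = 0"
    proof
      fix k assume k: "k \<in> {k\<in>ix. p k < t} - lift_ix x ` {j\<in>hat.ix. p (lift_ix x j) < t}"
      have "restrict k D \<noteq> restrict (idx x) D"
      proof
        assume eq: "restrict k D = restrict (idx x) D"
        have "k = lift_ix x (restrict k H)"
        proof
          fix i
          consider "i \<in> H" | "i \<in> D" | "i \<notin> I" using HD by auto
          then show "k i = lift_ix x (restrict k H) i"
          proof cases
            case 2
            then have "k i = restrict k D i" by simp
            also have "\<dots> = idx x i" using 2 unfolding eq by simp
            finally show ?thesis using 2 by simp
          next
            case 3
            have "k \<in> ix" "lift_ix x (restrict k H) \<in> ix" using k res lift_ix_in_ix by auto
            then show ?thesis using 3 by (auto simp: ix_def PiE_iff extensional_def)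
          qed simp
        qed
        then show False using k res[of k] by (metis (mono_tags, lifting) Diff_iff imageI mem_Collect_eq)
      qed
      then show "((f \<circ> pt) k - t) * (w \<circ> pt) k * G k = 0" by (simp add: G_def)
    qed
  qed (use finite_ix lift_ix_in_ix in auto)
  also have "\<dots> = (\<Sum>j\<in>{j\<in>hat.ix. p (lift_ix x j) < t}.
      (f (pt (lift_ix x j)) - t) * w (pt (lift_ix x j)) * g j)"
  proof (subst sum.reindex)
    show "inj_on (lift_ix x) {j\<in>hat.ix. p (lift_ix x j) < t}"
      using lift by (intro inj_on_inverseI[of _ "\<lambda>k. restrict k H"]) auto
    show "sum ((\<lambda>k. (f (pt k) - t) * w (pt k) * G k) \<circ> lift_ix x) {j\<in>hat.ix. p (lift_ix x j) < t} =
      (\<Sum>j\<in>{j\<in>hat.ix. p (lift_ix x j) < t}. (f (pt (lift_ix x j)) - t) * w (pt (lift_ix x j)) * g j)"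
      using lift by (intro sum.cong) (auto simp: G_def)
  qed
  finally show ?thesis .
qed

text \<open>Asking for \<open>p < t\<close> on every closed cell that contains the point makes the
  complement a finite union of closed cells, hence this set relatively open.\<close>

definition level :: "(nat \<Rightarrow> real) \<Rightarrow> real \<Rightarrow> (nat \<Rightarrow> real) set" where
  "level x t = {y \<in> rect H a b. \<forall>j\<in>hat.ix. y \<in> hat.cell j \<longrightarrow> p (lift_ix x j) < t}"

text \<open>All lifted cells around \<open>x\<close> must lie below \<open>t\<close>; they are
  adjacent to \<open>idx x\<close>, so the margin \<open>card I * J\<close> from
  \<open>p_adj\<close> is enough. That the set is lower rests on \<open>hat.cell_mono\<close>, which
  handles points on faces.\<close>

lemma level_lower_ro:
  assumes x: "x \<in> rect I a b" and t: "p (idx x) + card I * J < t"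
  shows "level x t \<in> lower_ro H \<sigma> (rect H a b) (restrict x H)"
proof -
  have "level x t = rect H a b \<inter> - (\<Union>j\<in>{j\<in>hat.ix. t \<le> p (lift_ix x j)}. hat.cell j)"
    by (auto simp: level_def not_le[symmetric])
  moreover have "closed (\<Union>j\<in>{j\<in>hat.ix. t \<le> p (lift_ix x j)}. hat.cell j)"
    using hat.finite_ix unfolding hat.cell_def
    by (intro closed_UN ballI compact_imp_closed compact_rect) auto
  ultimately have "openin (top_of_set (rect H a b)) (level x t)"
    unfolding openin_open by blast
  moreover have "y \<in> level x t"
    if y: "y \<in> rect H a b" "z \<in> rect H a b" "sig_le H \<sigma> y z" "z \<in> level x t" for y z
    unfolding level_def
  proof (intro CollectI conjI ballI impI)
    fix j assume j: "j \<in> hat.ix" "y \<in> hat.cell j"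
    have "\<exists>l\<in>hat.ix. z \<in> hat.cell l \<and> sig_le H \<sigma> (real \<circ> j) (real \<circ> l)"
      by (rule hat.cell_mono[OF j y(2,3)]) (rule \<sigma>_H)
    then obtain l where l: "l \<in> hat.ix" "z \<in> hat.cell l" "sig_le H \<sigma> (real \<circ> j) (real \<circ> l)"
      by blast
    have "sig_le I \<sigma> (real \<circ> lift_ix x j) (real \<circ> lift_ix x l)"
      unfolding sig_le_def
    proof
      fix i assume "i \<in> I"
      then consider "i \<in> H" | "i \<in> D" using HD(1) by auto
      then show "(\<sigma> i \<in> {-1, 1} \<longrightarrow> of_int (\<sigma> i) * (real \<circ> lift_ix x j) i \<le> of_int (\<sigma> i) * (real \<circ> lift_ix x l) i)
          \<and> (\<sigma> i = 0 \<longrightarrow> (real \<circ> lift_ix x j) i = (real \<circ> lift_ix x l) i)"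
      proof cases
        case 1
        then show ?thesis using bspec[OF l(3)[unfolded sig_le_def] 1] by simp
      next
        case 2
        then show ?thesis using \<sigma>_D[OF 2] by simp
      qed
    qed
    then have "p (lift_ix x j) \<le> p (lift_ix x l)"
      using j l by (intro p_mono lift_ix_in_ix)
    also have "\<dots> < t" using y(4) l by (auto simp: level_def)
    finally show "p (lift_ix x j) < t" .
  qed (use y in auto)
  moreover have "restrict x H \<in> level x t"
    unfolding level_def
  proof (intro CollectI conjI ballI impI)
    show "restrict x H \<in> rect H a b" using x HD(1) by (auto simp: rect_def)
    fix j assume j: "j \<in> hat.ix" "restrict x H \<in> hat.cell j"
    have "adj (lift_ix x j) (idx x)"
      unfolding adj_def
    proof
      fix i assume "i \<in> I"
      then consider "i \<in> H" | "i \<in> D" using HD(1) by auto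
      then show "lift_ix x j i \<le> idx x i + 1 \<and> idx x i \<le> lift_ix x j i + 1"
      proof cases
        case 1
        have "hat.adj (hat.idx (restrict x H)) j" by (rule hat.idx_cell_adj[OF j])
        moreover have "hat.idx (restrict x H) i = idx x i"
          using 1 \<open>i \<in> I\<close> by (simp add: hat.idx_def idx_def)
        ultimately show ?thesis using 1 by (auto simp: hat.adj_def)
      qed auto
    qed
    from p_adj[OF lift_ix_in_ix[OF j(1)] idx_in_ix this]
    show "p (lift_ix x j) < t" using t by simp
  qed
  ultimately show ?thesis
    unfolding lower_ro_def by (auto simp: level_def)
qed

text \<open>At a fixed offset the indicator of \<open>U\<close> is a nonnegative monotone function
  on the fibre, so \<open>sum_slice_nonpos\<close> gives the sign of the sum over
  \<open>level x t\<close>; integrating over the offset gives the sign required by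
  \<open>Av_le\<close>, for every \<open>U\<close>.\<close>

lemma av_is_le:
  assumes x: "x \<in> rect I a b"
  shows "av_is H \<sigma> (rect H a b) (slice I \<sigma> w x) (slice I \<sigma> f x) (restrict x H)
    \<le> p (idx x) + (card I + 1) * J"
proof -
  interpret av: averages H a b "slice I \<sigma> f x" "slice I \<sigma> w x" M "rect H a b"
    by (rule averages_slice[OF x])
  let ?A = "av_is H \<sigma> (rect H a b) (slice I \<sigma> w x) (slice I \<sigma> f x) (restrict x H)"
  have xR: "restrict x H \<in> rect H a b" using x HD(1) by (auto simp: rect_def)
  have "?A - J \<le> t" if t: "p (idx x) + card I * J < t" for t
  proof (cases "t \<le> M")
    \<comment> \<open>\<open>slice_residual_le\<close> needs \<open>\<bar>t\<bar> \<le> M\<close>;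
      beyond \<open>M\<close> the trivial bound on averages takes over.\<close>
    case False
    then show ?thesis using av.av_is_le_bound[OF xR, of \<sigma>] nonneg by simp
  next
    case True
    have tM: "\<bar>t\<bar> \<le> M"
    proof -
      have "0 \<le> card I * J" using nonneg by simp
      then show ?thesis using p_abs_le[OF idx_in_ix[of x]] True t by (simp add: abs_le_iff)
    qed
    have "?A \<le> t + J"
    proof (rule av.av_is_leI[OF xR level_lower_ro[OF x t]])
      fix U assume U: "U \<in> upper_ro H \<sigma> (rect H a b) (restrict x H)"
      let ?E = "level x t \<inter> U"
      note E = av.lower_upper_ro[OF level_lower_ro[OF x t] U]
      show "Av H (slice I \<sigma> f x) (slice I \<sigma> w x) ?E \<le> t + J"
      proof (rule av.Av_le[OF E], rule hat.integral_rect_nonpos)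
        show "integrable (lborel_Pi H) (\<lambda>y. indicator (rect H a b) y *
            (indicator ?E y * ((slice I \<sigma> f x y - (t + J)) * slice I \<sigma> w x y)))"
          using av.h(1) av.v(1) sets_openin_rect[OF hat.I E(1)]
          by (intro integrable_continuous_on_rect_indicator hat.I continuous_intros)
        show "AE z in lborel_Pi H. z \<in> hat.base \<longrightarrow> (\<Sum>j\<in>hat.ix. indicator ?E (hat.shift j z) *
            ((slice I \<sigma> f x (hat.shift j z) - (t + J)) * slice I \<sigma> w x (hat.shift j z))) \<le> 0"
        proof (rule AE_I2, rule impI)
          fix z assume z: "z \<in> space (lborel_Pi H)" "z \<in> hat.base"
          define g where "g j = indicat_real U (hat.shift j z)" for j
          have cell: "hat.shift j z \<in> hat.ocell j" for j
            using z by (simp add: hat.shift_ocell)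
          have rect: "hat.shift j z \<in> rect H a b" if "j \<in> hat.ix" for j
            using cell[of j] hat.ocell_subset[of j] hat.cell_subset[OF that] by auto
          \<comment> \<open>The point lies in an open cell, which meets no other closed cell of the
            grid, so the quantifier in \<open>level\<close> reduces to \<open>j\<close>.\<close>
          have lev: "hat.shift j z \<in> level x t \<longleftrightarrow> p (lift_ix x j) < t" if "j \<in> hat.ix" for j
            using hat.ocell_unique[OF that _ cell[of j]] cell[of j] hat.ocell_subset[of j] rect[OF that] that
            by (auto simp: level_def)
          have "(\<Sum>j\<in>hat.ix. indicator ?E (hat.shift j z) *
              ((slice I \<sigma> f x (hat.shift j z) - (t + J)) * slice I \<sigma> w x (hat.shift j z)))
            \<le> (\<Sum>j\<in>hat.ix. if p (lift_ix x j) < t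
                 then (f (pt (lift_ix x j)) - t) * w (pt (lift_ix x j)) * g j else 0)"
          proof (rule sum_mono)
            fix j assume j: "j \<in> hat.ix"
            have "hat.shift j z \<in> hat.cell j" using cell[of j] hat.ocell_subset[of j] by auto
            from slice_residual_le[OF x j this tM]
            show "indicator ?E (hat.shift j z) *
              ((slice I \<sigma> f x (hat.shift j z) - (t + J)) * slice I \<sigma> w x (hat.shift j z))
              \<le> (if p (lift_ix x j) < t
                 then (f (pt (lift_ix x j)) - t) * w (pt (lift_ix x j)) * g j else 0)"
              by (simp add: indicator_def g_def lev[OF j])
          qed
          also have "\<dots> = (\<Sum>j\<in>{j\<in>hat.ix. p (lift_ix x j) < t}.
              (f (pt (lift_ix x j)) - t) * w (pt (lift_ix x j)) * g j)"
            using hat.finite_ix by (simp add: sum.inter_filter)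
          also have "\<dots> \<le> 0"
          proof (rule sum_slice_nonpos[OF x])
            show "0 \<le> g j" for j by (simp add: g_def)
            fix j l assume jl: "j \<in> hat.ix" "l \<in> hat.ix" "sig_le H \<sigma> (real \<circ> j) (real \<circ> l)"
            have "sig_le H \<sigma> (hat.shift j z) (hat.shift l z)"
              by (rule hat.shift_mono[OF jl(3)])
            then have "hat.shift j z \<in> U \<Longrightarrow> hat.shift l z \<in> U"
              using U rect jl by (auto simp: upper_ro_def)
            then show "g j \<le> g l" by (auto simp: g_def indicator_def)
          qed
          finally show "(\<Sum>j\<in>hat.ix. indicator ?E (hat.shift j z) *
            ((slice I \<sigma> f x (hat.shift j z) - (t + J)) * slice I \<sigma> w x (hat.shift j z))) \<le> 0" .
        qed
      qed
    qed
    then show ?thesis by simp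
  qed
  \<comment> \<open>Only thresholds strictly above the margin give an admissible lower set; the
    bound itself follows as \<open>t\<close> decreases to it.\<close>
  then have "?A - J \<le> p (idx x) + card I * J" by (rule dense_ge)
  then show ?thesis by (simp add: algebra_simps)
qed

lemma av_is_near:
  assumes x: "x \<in> rect I a b"
  defines "A \<equiv> \<lambda>av. av H \<sigma> (rect H a b) (slice I \<sigma> w x) (slice I \<sigma> f x) (restrict x H)"
  shows "A av_is \<le> p (idx x) + (card I + 1) * J" "p (idx x) - (card I + 1) * J \<le> A av_si"
    "A av_si \<le> A av_is"
proof -
  show "A av_is \<le> p (idx x) + (card I + 1) * J" unfolding A_def by (rule av_is_le[OF x])
  interpret av: averages H a b "slice I \<sigma> f x" "slice I \<sigma> w x" M "rect H a b"
    by (rule averages_slice[OF x])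
  have "restrict x H \<in> rect H a b" using x HD(1) by (auto simp: rect_def)
  then show "A av_si \<le> A av_is" unfolding A_def by (rule av.av_si_le_av_is)
  have coords: "hat_coords I (\<lambda>i. - \<sigma> i) = H" "dot_coords I (\<lambda>i. - \<sigma> i) = D"
    using minus_equation_iff[of "\<sigma> _" 1] by (auto simp: hat_coords_def dot_coords_def)
  have "slice I (\<lambda>i. - \<sigma> i) w x = slice I \<sigma> w x"
    "slice I (\<lambda>i. - \<sigma> i) (\<lambda>x. - f x) x = (\<lambda>y. - slice I \<sigma> f x y)"
    by (simp_all add: slice_def coords)
  with grid_proj.av_is_le[OF uminus x]
  have "av_is H (\<lambda>i. - \<sigma> i) (rect H a b) (slice I \<sigma> w x) (\<lambda>y. - slice I \<sigma> f x y) (restrict x H)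
    \<le> - p (idx x) + (card I + 1) * J"
    by (simp add: coords J_def grid_proj.J_def[OF uminus])
  moreover have "A av_si = - av_is H (\<lambda>i. - \<sigma> i) (rect H a b) (slice I \<sigma> w x) (\<lambda>y. - slice I \<sigma> f x y) (restrict x H)"
    unfolding A_def using \<sigma>_H by (intro av_si_uminus) auto
  ultimately show "p (idx x) - (card I + 1) * J \<le> A av_si" by simp
qed

end

section \<open>The continuous limit\<close>

text \<open>A telescope changing one factor at a time. It is applied to \<open>f - q\<close>,
  \<open>g - q\<close>, \<open>w\<close> and their grid versions, with \<open>G\<close> the size of
  \<open>g\<close>; the bound is linear in \<open>G\<close> and hence integrable for integrable
  \<open>g\<close>.\<close>

lemma product_diff_le:
  fixes A A' B B' w w' M W e G :: real
  assumes "\<bar>A'\<bar> \<le> 2 * M" "\<bar>A - A'\<bar> \<le> 2 * e" "\<bar>B\<bar> \<le> G + M" "\<bar>B'\<bar> \<le> G + M" "\<bar>B - B'\<bar> \<le> e"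
    "\<bar>w\<bar> \<le> W" "\<bar>w - w'\<bar> \<le> e"
  shows "A * B * w - A' * B' * w' \<le> e * ((2 * W + 2 * M) * G + (4 * W * M + 2 * M * M))"
proof -
  have mult: "x * y * z \<le> X * Y * Z" if "\<bar>x\<bar> \<le> X" "\<bar>y\<bar> \<le> Y" "\<bar>z\<bar> \<le> Z" for x y z X Y Z :: real
  proof -
    have "x * y * z \<le> \<bar>x\<bar> * \<bar>y\<bar> * \<bar>z\<bar>" by (metis abs_ge_self abs_mult)
    also have "\<dots> \<le> X * Y * Z" using that by (intro mult_mono mult_nonneg_nonneg) auto
    finally show ?thesis .
  qed
  have "A * B * w - A' * B' * w' = (A - A') * B * w + A' * (B - B') * w + A' * B' * (w - w')"
    by (simp add: algebra_simps)
  also have "\<dots> \<le> 2 * e * (G + M) * W + 2 * M * e * W + 2 * M * (G + M) * e"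
    using assms by (intro add_mono mult)
  finally show ?thesis by (simp add: algebra_simps)
qed

lemma integrable_rect_mult:
  fixes c g :: "(nat \<Rightarrow> real) \<Rightarrow> real"
  assumes I: "finite I" and c: "continuous_on (rect I a b) c"
    and g: "integrable (lborel_Pi I) (\<lambda>x. indicator (rect I a b) x * g x)"
  shows "integrable (lborel_Pi I) (\<lambda>x. indicator (rect I a b) x * (c x * g x))"
proof -
  have "bounded (c ` rect I a b)"
    using compact_continuous_image[OF c compact_rect] by (rule compact_imp_bounded)
  then obtain B where B: "\<And>x. x \<in> rect I a b \<Longrightarrow> \<bar>c x\<bar> \<le> B"
    unfolding bounded_iff by auto
  have *: "indicator (rect I a b) x * (c x * g x)
      = (indicator (rect I a b) x * c x) * (indicator (rect I a b) x * g x)" for x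
    by (simp add: indicator_def)
  show ?thesis
  proof (rule Bochner_Integration.integrable_bound)
    show "integrable (lborel_Pi I) (\<lambda>x. B * (indicator (rect I a b) x * g x))"
      using g by simp
    show "(\<lambda>x. indicator (rect I a b) x * (c x * g x)) \<in> borel_measurable (lborel_Pi I)"
      unfolding *
      by (rule borel_measurable_times[OF measurable_continuous_on_rect[OF I c] borel_measurable_integrable[OF g]])
    show "AE x in lborel_Pi I. norm (indicator (rect I a b) x * (c x * g x))
        \<le> norm (B * (indicator (rect I a b) x * g x))"
      using B by (intro AE_I2) (force simp: indicator_def abs_mult intro!: mult_right_mono)
  qed
qed

text \<open>For almost every offset all translates avoid \<open>N\<close>, so sampling
  \<open>g\<close> at that offset gives an admissible competitor for \<open>p\<close>. Passing from
  corner values and \<open>p\<close> to \<open>f\<close>, \<open>w\<close> and \<open>q\<close>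
  costs an error proportional to \<open>e\<close>.\<close>

lemma (in grid_proj) variational_approx:
  fixes q g :: "(nat \<Rightarrow> real) \<Rightarrow> real"
  assumes q: "continuous_on (rect I a b) q" "\<And>x. x \<in> rect I a b \<Longrightarrow> \<bar>q x\<bar> \<le> M"
      "\<And>x. x \<in> rect I a b \<Longrightarrow> \<bar>q x - p (idx x)\<bar> \<le> e"
    and \<omega>: "\<omega> \<le> e" and W: "\<And>x. x \<in> rect I a b \<Longrightarrow> \<bar>w x\<bar> \<le> W"
    and g: "integrable (lborel_Pi I) (\<lambda>x. indicator (rect I a b) x * g x)"
    and N: "N \<in> null_sets (lborel_Pi I)" "sig_mono_on I \<sigma> (rect I a b - N) g"
  shows "(\<integral>x. indicator (rect I a b) x * ((f x - q x) * (g x - q x) * w x) \<partial>lborel_Pi I)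
    \<le> e * (\<integral>x. indicator (rect I a b) x * ((2 * W + 2 * M) * \<bar>g x\<bar> + (4 * W * M + 2 * M * M)) \<partial>lborel_Pi I)"
proof -
  let ?R = "rect I a b"
  define \<alpha> \<beta> where "\<alpha> = 2 * W + 2 * M" and "\<beta> = 4 * W * M + 2 * M * M"
  have i1: "integrable (lborel_Pi I) (\<lambda>x. indicator ?R x * ((f x - q x) * (g x - q x) * w x))"
  proof -
    have "integrable (lborel_Pi I) (\<lambda>x. indicator ?R x * (((f x - q x) * w x) * g x)
        - indicator ?R x * ((f x - q x) * w x * q x))"
      by (intro Bochner_Integration.integrable_diff integrable_rect_mult integrable_continuous_on_rect
          continuous_intros I f w q g)
    then show ?thesis by (simp add: algebra_simps)
  qed
  have i2: "integrable (lborel_Pi I) (\<lambda>x. indicator ?R x * (\<alpha> * \<bar>g x\<bar> + \<beta>))"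
  proof -
    have "integrable (lborel_Pi I) (\<lambda>x. \<alpha> * \<bar>indicator ?R x * g x\<bar> + indicator ?R x * \<beta>)"
      by (rule Bochner_Integration.integrable_add[OF integrable_mult_right[OF integrable_abs[OF g]]
          integrable_continuous_on_rect[OF I continuous_on_const]])
    then show ?thesis by (simp add: algebra_simps abs_mult)
  qed
  \<comment> \<open>Subtracting the replacement error pointwise makes the finite sums nonpositive,
    as \<open>integral_rect_nonpos\<close> requires.\<close>
  define F where "F x = (f x - q x) * (g x - q x) * w x - e * (\<alpha> * \<bar>g x\<bar> + \<beta>)" for x
  have F_eq: "indicator ?R x * F x = indicator ?R x * ((f x - q x) * (g x - q x) * w x)
      - e * (indicator ?R x * (\<alpha> * \<bar>g x\<bar> + \<beta>))" for x
    by (simp add: F_def algebra_simps)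
  have "(\<integral>x. indicator ?R x * F x \<partial>lborel_Pi I) \<le> 0"
  proof (rule integral_rect_nonpos)
    show "integrable (lborel_Pi I) (\<lambda>x. indicator ?R x * F x)"
      unfolding F_eq using i1 i2 by simp
    have "AE z in lborel_Pi I. \<forall>k\<in>ix. shift k z \<notin> N"
      using finite_ix N(1) by (intro AE_finite_allI AE_shift AE_not_in)
    then show "AE z in lborel_Pi I. z \<in> base \<longrightarrow> (\<Sum>k\<in>ix. F (shift k z)) \<le> 0"
      using AE_space
    proof eventually_elim
      case (elim z)
      show ?case
      proof
        assume z: "z \<in> base"
        have cell: "shift k z \<in> ocell k" for k using z elim by (simp add: shift_ocell)
        then have cell': "shift k z \<in> cell k" for k using ocell_subset by blast
        have rect: "shift k z \<in> ?R" if "k \<in> ix" for k using cell'[of k] cell_subset[OF that] by auto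
        have "monotone_on ix (\<lambda>k l. sig_le I \<sigma> (real \<circ> k) (real \<circ> l)) (\<le>) (\<lambda>k. g (shift k z))"
        proof (rule monotone_onI)
          fix k l assume kl: "k \<in> ix" "l \<in> ix" "sig_le I \<sigma> (real \<circ> k) (real \<circ> l)"
          show "g (shift k z) \<le> g (shift l z)"
            by (rule monotone_onD[OF N(2)]) (use kl elim rect shift_mono in auto)
        qed
        then have "(\<Sum>k\<in>ix. ((f \<circ> pt) k - p k) * (w \<circ> pt) k * (g (shift k z) - p k)) \<le> 0"
          using p by (simp add: isotonic_proj_def)
        moreover have "(\<Sum>k\<in>ix. F (shift k z))
            \<le> (\<Sum>k\<in>ix. ((f \<circ> pt) k - p k) * (w \<circ> pt) k * (g (shift k z) - p k))"
        proof (rule sum_mono)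
          fix k assume k: "k \<in> ix"
          define x where "x = shift k z"
          have x: "x \<in> ?R" "idx x = k" using rect[OF k] idx_ocell[OF k cell] by (auto simp: x_def)
          have o: "\<bar>f x - f (pt k)\<bar> \<le> e" "\<bar>w x - w (pt k)\<bar> \<le> e"
            using osc_cell[OF k cell'[of k]] \<omega> by (auto simp: x_def)
          have qx: "\<bar>q x - p k\<bar> \<le> e" "\<bar>q x\<bar> \<le> M" using q(2,3)[OF x(1)] x(2) by auto
          have pM: "\<bar>p k\<bar> \<le> M" "\<bar>f (pt k)\<bar> \<le> M"
            using p_abs_le[OF k] f(2)[OF pt_in_rect[OF k]] by auto
          have "(f x - q x) * (g x - q x) * w x - (f (pt k) - p k) * (g x - p k) * w (pt k)
             \<le> e * (\<alpha> * \<bar>g x\<bar> + \<beta>)"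
            unfolding \<alpha>_def \<beta>_def using o qx pM W[OF x(1)]
            by (intro product_diff_le) (auto simp: abs_le_iff)
          then show "F (shift k z) \<le> ((f \<circ> pt) k - p k) * (w \<circ> pt) k * (g (shift k z) - p k)"
            by (simp add: F_def x_def[symmetric] mult.commute mult.left_commute)
        qed
        ultimately show "(\<Sum>k\<in>ix. F (shift k z)) \<le> 0" by linarith
      qed
    qed
  qed
  then show ?thesis
    unfolding F_eq using i1 i2 by (simp add: \<alpha>_def \<beta>_def)
qed

text \<open>The tolerance depends on the coordinate because the sides of a grid cell do.\<close>

lemma continuous_on_rectI:
  fixes g :: "(nat \<Rightarrow> real) \<Rightarrow> real"
  assumes I: "finite I"
    and g: "\<And>\<epsilon>. 0 < \<epsilon> \<Longrightarrow> \<exists>d. (\<forall>i\<in>I. 0 < d i) \<and>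
      (\<forall>x\<in>S. \<forall>y\<in>S. (\<forall>i\<in>I. \<bar>x i - y i\<bar> \<le> d i) \<longrightarrow> \<bar>g x - g y\<bar> < \<epsilon>)"
  shows "continuous_on S g"
  unfolding continuous_on_def
proof (intro ballI tendstoI)
  fix x and \<epsilon> :: real assume x: "x \<in> S" and "0 < \<epsilon>"
  from g[OF this(2)] obtain d where d: "\<And>i. i \<in> I \<Longrightarrow> (0::real) < d i"
    "\<And>x y. x \<in> S \<Longrightarrow> y \<in> S \<Longrightarrow> (\<forall>i\<in>I. \<bar>x i - y i\<bar> \<le> d i) \<Longrightarrow> \<bar>g x - g y\<bar> < \<epsilon>"
    by blast
  have "eventually (\<lambda>y. \<forall>i\<in>I. \<bar>x i - y i\<bar> \<le> d i) (at x within S)"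
  proof (rule eventually_ball_finite[OF I], rule ballI)
    fix i assume i: "i \<in> I"
    have "continuous_on S (\<lambda>y. y i)" for i :: nat
      by (rule continuous_on_subset[OF continuous_on_product_coordinates]) simp
    then have "((\<lambda>y. y i) \<longlongrightarrow> x i) (at x within S)"
      using x by (simp add: continuous_on_def)
    from tendstoD[OF this d(1)[OF i]]
    show "eventually (\<lambda>y. \<bar>x i - y i\<bar> \<le> d i) (at x within S)"
      by eventually_elim (simp add: dist_real_def abs_minus_commute)
  qed
  moreover have "eventually (\<lambda>y. y \<in> S) (at x within S)"
    by (simp add: eventually_at_topological) (use open_UNIV in blast)
  ultimately show "eventually (\<lambda>y. dist (g y) (g x) < \<epsilon>) (at x within S)"
    by eventually_elim (use d(2)[OF x] in \<open>auto simp: dist_real_def abs_minus_commute\<close>)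
qed

lemma nonpos_if_le_mult_eps:
  fixes u c :: real
  assumes "\<And>e. 0 < e \<Longrightarrow> u \<le> K * e" "0 \<le> K"
  shows "u \<le> 0"
proof (rule field_le_epsilon)
  fix e :: real assume "0 < e"
  then have "u \<le> K * (e / (K + 1))" using assms(2) by (intro assms(1)) auto
  also have "\<dots> \<le> e" using \<open>0 < e\<close> assms(2) by (simp add: field_simps)
  finally show "u \<le> 0 + e" by simp
qed

section \<open>The averages as limits of grid projections\<close>

locale isotonic_problem =
  fixes I :: "nat set" and a b :: "nat \<Rightarrow> real" and \<sigma> :: "nat \<Rightarrow> int"
    and f w :: "(nat \<Rightarrow> real) \<Rightarrow> real" and Q
  assumes I: "finite I" and ab: "\<And>i. i \<in> I \<Longrightarrow> a i < b i"
    and \<sigma>: "\<And>i. i \<in> I \<Longrightarrow> \<sigma> i \<in> {-1, 0, 1}" and Q: "Q = rect I a b"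
    and f: "continuous_on Q f" and w: "continuous_on Q w" "\<And>x. x \<in> Q \<Longrightarrow> 0 < w x"
begin

text \<open>The averaging expression itself is the candidate for the continuous representative; it
  does not depend on a grid, so no limit function has to be constructed.\<close>

definition "f_is x = av_is (hat_coords I \<sigma>) \<sigma> (rect (hat_coords I \<sigma>) a b) (slice I \<sigma> w x)
  (slice I \<sigma> f x) (restrict x (hat_coords I \<sigma>))"
definition "f_si x = av_si (hat_coords I \<sigma>) \<sigma> (rect (hat_coords I \<sigma>) a b) (slice I \<sigma> w x)
  (slice I \<sigma> f x) (restrict x (hat_coords I \<sigma>))"
definition "M = (SUP x\<in>Q. \<bar>f x\<bar>)"
definition "m = (INF x\<in>Q. w x)"

lemma Q_nonempty: "Q \<noteq> {}"
  using ab by (auto simp: Q rect_def PiE_eq_empty_iff intro: less_imp_le)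

lemma f_le_M: "x \<in> Q \<Longrightarrow> \<bar>f x\<bar> \<le> M"
  unfolding M_def
  by (intro cSUP_upper bounded_imp_bdd_above compact_imp_bounded compact_continuous_image continuous_intros f)
     (auto simp: Q compact_rect)

lemma m: "0 < m" "\<And>x. x \<in> Q \<Longrightarrow> m \<le> w x"
proof -
  obtain x where x: "x \<in> Q" "\<And>y. y \<in> Q \<Longrightarrow> w x \<le> w y"
    using continuous_attains_inf[OF _ Q_nonempty w(1)] by (auto simp: Q compact_rect)
  then have "m = w x"
    unfolding m_def by (intro cInf_eq_minimum) auto
  then show "0 < m" "\<And>x. x \<in> Q \<Longrightarrow> m \<le> w x" using x w(2) by auto
qed

lemma grid_approximation:
  assumes e: "0 < e"
  shows "\<exists>n p \<omega>. grid_proj I a b n \<sigma> f w p M m \<omega> \<and> \<omega> \<le> e \<and> (card I + 1) * (\<omega> + 2 * M * \<omega> / m) \<le> e"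
proof -
  have M0: "0 \<le> M" using Q_nonempty f_le_M by fastforce
  \<comment> \<open>Chosen so that \<open>(card I + 1) * (\<omega> + 2 * M * \<omega> / m) = C *
    \<omega>\<close>; \<open>C \<ge> 1\<close> yields \<open>\<omega> \<le> e\<close> as
    well.\<close>
  define C where "C = (card I + 1) * (1 + 2 * M / m)"
  have "1 * 1 \<le> C" unfolding C_def using M0 m(1) by (intro mult_mono) auto
  then have C: "1 \<le> C" by simp
  define \<omega> where "\<omega> = e / C"
  have \<omega>: "0 < \<omega>" "\<omega> \<le> e" "C * \<omega> = e"
    using e C by (auto simp: \<omega>_def field_simps)
  obtain \<delta>1 \<delta>2 where \<delta>: "0 < \<delta>1" "0 < \<delta>2"
    "\<And>x y. x \<in> Q \<Longrightarrow> y \<in> Q \<Longrightarrow> (\<forall>i\<in>I. \<bar>x i - y i\<bar> \<le> \<delta>1) \<Longrightarrow> \<bar>f x - f y\<bar> \<le> \<omega>"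
    "\<And>x y. x \<in> Q \<Longrightarrow> y \<in> Q \<Longrightarrow> (\<forall>i\<in>I. \<bar>x i - y i\<bar> \<le> \<delta>2) \<Longrightarrow> \<bar>w x - w y\<bar> \<le> \<omega>"
    using continuous_on_rect_uniform[OF f[unfolded Q] \<omega>(1)]
      continuous_on_rect_uniform[OF w(1)[unfolded Q] \<omega>(1)] unfolding Q by metis
  define \<delta> where "\<delta> = min \<delta>1 \<delta>2"
  have \<delta>0: "0 < \<delta>" using \<delta> by (simp add: \<delta>_def)
  \<comment> \<open>The sum of the side lengths dominates each of them, so one \<open>n\<close>
    serves all coordinates; the \<open>+ 1\<close> keeps it positive.\<close>
  define n where "n = nat \<lceil>(\<Sum>i\<in>I. b i - a i) / \<delta>\<rceil> + 1"
  have n: "0 < n" "(\<Sum>i\<in>I. b i - a i) / \<delta> \<le> n" unfolding n_def by linarith+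
  have len: "(b i - a i) / n \<le> \<delta>" if "i \<in> I" for i
  proof -
    have "b i - a i \<le> (\<Sum>i\<in>I. b i - a i)"
      using I ab that by (intro member_le_sum) (auto intro: less_imp_le)
    also have "\<dots> \<le> n * \<delta>" using n(2) \<delta>0 by (simp add: pos_divide_le_eq)
    finally show ?thesis using n(1) by (simp add: pos_divide_le_eq mult.commute)
  qed
  interpret grid I a b n using I ab n by unfold_locales auto
  have "\<exists>p. isotonic_proj ix (\<lambda>k l. sig_le I \<sigma> (real \<circ> k) (real \<circ> l)) (w \<circ> pt) (f \<circ> pt) p"
    using w(2) pt_in_rect by (intro isotonic_proj_exists finite_ix) (auto simp: Q)
  then obtain p where p: "isotonic_proj ix (\<lambda>k l. sig_le I \<sigma> (real \<circ> k) (real \<circ> l)) (w \<circ> pt) (f \<circ> pt) p"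
    by blast
  have "grid_proj I a b n \<sigma> f w p M m \<omega>"
  proof unfold_locales
    fix x y assume xy: "x \<in> rect I a b" "y \<in> rect I a b" "\<And>i. i \<in> I \<Longrightarrow> \<bar>x i - y i\<bar> \<le> (b i - a i) / n"
    have "\<bar>x i - y i\<bar> \<le> \<delta>1" "\<bar>x i - y i\<bar> \<le> \<delta>2" if "i \<in> I" for i
      using xy(3)[OF that] len[OF that] by (auto simp: \<delta>_def)
    then show "\<bar>f x - f y\<bar> \<le> \<omega> \<and> \<bar>w x - w y\<bar> \<le> \<omega>" using \<delta>(3,4) xy(1,2) Q by auto
  qed (use \<sigma> f w(1) m f_le_M p Q in auto)
  moreover have "(card I + 1) * (\<omega> + 2 * M * \<omega> / m) = C * \<omega>"
    by (simp add: C_def algebra_simps)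
  ultimately show ?thesis using \<omega> by (intro exI[of _ n] exI[of _ p] exI[of _ \<omega>]) simp
qed

text \<open>The interface for the limit: a statement about \<open>f_is\<close> or
  \<open>f_si\<close> is proved up to a multiple of \<open>e\<close> on a suitable grid, and then
  \<open>e\<close> tends to 0.\<close>

lemma grid_approximation_f_is:
  assumes e: "0 < e"
  obtains n p \<omega> where "grid_proj I a b n \<sigma> f w p M m \<omega>" "\<omega> \<le> e"
    "\<And>k l. k \<in> grid.ix I n \<Longrightarrow> l \<in> grid.ix I n \<Longrightarrow> grid.adj I k l \<Longrightarrow> p k - p l \<le> e"
    "\<And>x. x \<in> Q \<Longrightarrow> \<bar>f_is x - p (grid.idx I a b n x)\<bar> \<le> e"
    "\<And>x. x \<in> Q \<Longrightarrow> \<bar>f_is x - f_si x\<bar> \<le> 2 * e"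
proof -
  from grid_approximation[OF e] obtain n p \<omega> where
    gp: "grid_proj I a b n \<sigma> f w p M m \<omega>" "\<omega> \<le> e" "(card I + 1) * (\<omega> + 2 * M * \<omega> / m) \<le> e" by blast
  interpret grid_proj I a b n \<sigma> f w p M m \<omega> by (rule gp)
  have J: "(card I + 1) * J \<le> e" using gp(3) by (simp add: J_def)
  moreover have "card I * J \<le> (card I + 1) * J" using nonneg by (intro mult_right_mono) auto
  ultimately have J': "card I * J \<le> e" by linarith
  show thesis
  proof
    show "p k - p l \<le> e" if "k \<in> ix" "l \<in> ix" "adj k l" for k l
      using p_adj[OF that] J' by simp
    show "\<bar>f_is x - p (idx x)\<bar> \<le> e" "\<bar>f_is x - f_si x\<bar> \<le> 2 * e" if "x \<in> Q" for x
    proof -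
      have "f_is x \<le> p (idx x) + (card I + 1) * J" "p (idx x) - (card I + 1) * J \<le> f_si x" "f_si x \<le> f_is x"
        unfolding f_is_def f_si_def using av_is_near[of x] that by (auto simp: Q)
      then show "\<bar>f_is x - p (idx x)\<bar> \<le> e" "\<bar>f_is x - f_si x\<bar> \<le> 2 * e"
        using J by (auto simp: abs_le_iff)
    qed
  qed (use gp in auto)
qed

lemma f_si_eq: "x \<in> Q \<Longrightarrow> f_si x = f_is x"
proof -
  assume x: "x \<in> Q"
  have "\<bar>f_is x - f_si x\<bar> \<le> 0"
  proof (rule nonpos_if_le_mult_eps[where K = 2])
    fix e :: real assume e: "0 < e"
    obtain n p \<omega> where "\<And>x. x \<in> Q \<Longrightarrow> \<bar>f_is x - f_si x\<bar> \<le> 2 * e"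
      using grid_approximation_f_is[OF e] by metis
    then show "\<bar>f_is x - f_si x\<bar> \<le> 2 * e" using x by simp
  qed simp
  then show ?thesis by simp
qed

text \<open>\<open>idx\<close> preserves the order exactly, not merely up to a cell, so the only
  errors are those of the approximation at the two points.\<close>

lemma f_is_mono: "sig_mono_on I \<sigma> Q f_is"
proof (rule monotone_onI)
  fix x y assume xy: "x \<in> Q" "y \<in> Q" "sig_le I \<sigma> x y"
  have "f_is x - f_is y \<le> 0"
  proof (rule nonpos_if_le_mult_eps[where K = 2])
    fix e :: real assume e: "0 < e"
    obtain n p \<omega> where gp: "grid_proj I a b n \<sigma> f w p M m \<omega>"
        "\<And>x. x \<in> Q \<Longrightarrow> \<bar>f_is x - p (grid.idx I a b n x)\<bar> \<le> e"
      using grid_approximation_f_is[OF e] by metis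
    interpret grid_proj I a b n \<sigma> f w p M m \<omega> by (rule gp)
    have "p (idx x) \<le> p (idx y)" by (intro p_mono idx_in_ix idx_mono xy)
    then show "f_is x - f_is y \<le> 2 * e" using gp(2)[OF xy(1)] gp(2)[OF xy(2)] by linarith
  qed simp
  then show "f_is x \<le> f_is y" by simp
qed

lemma f_is_le_M: "x \<in> Q \<Longrightarrow> \<bar>f_is x\<bar> \<le> M"
proof -
  assume x: "x \<in> Q"
  have "\<bar>f_is x\<bar> - M \<le> 0"
  proof (rule nonpos_if_le_mult_eps[where K = 1])
    fix e :: real assume e: "0 < e"
    obtain n p \<omega> where gp: "grid_proj I a b n \<sigma> f w p M m \<omega>"
        "\<And>x. x \<in> Q \<Longrightarrow> \<bar>f_is x - p (grid.idx I a b n x)\<bar> \<le> e"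
      using grid_approximation_f_is[OF e] by metis
    interpret grid_proj I a b n \<sigma> f w p M m \<omega> by (rule gp)
    show "\<bar>f_is x\<bar> - M \<le> 1 * e" using p_abs_le[OF idx_in_ix[of x]] gp(2)[OF x] by linarith
  qed simp
  then show ?thesis by simp
qed

text \<open>Points within one cell side of each other have adjacent indices; two approximation
  errors and one jump, each at most \<epsilon>/4, stay below \<epsilon>. All coordinates are treated
  alike, including those with signature \<open>0\<close>.\<close>

lemma f_is_continuous: "continuous_on Q f_is"
proof (rule continuous_on_rectI[OF I])
  fix \<epsilon> :: real assume "0 < \<epsilon>"
  then have e: "0 < \<epsilon> / 4" by simp
  obtain n p \<omega> where gp: "grid_proj I a b n \<sigma> f w p M m \<omega>"
      "\<And>k l. k \<in> grid.ix I n \<Longrightarrow> l \<in> grid.ix I n \<Longrightarrow> grid.adj I k l \<Longrightarrow> p k - p l \<le> \<epsilon> / 4"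
      "\<And>x. x \<in> Q \<Longrightarrow> \<bar>f_is x - p (grid.idx I a b n x)\<bar> \<le> \<epsilon> / 4"
    using grid_approximation_f_is[OF e] by metis
  interpret grid_proj I a b n \<sigma> f w p M m \<omega> by (rule gp)
  have lt: "\<bar>f_is x - f_is y\<bar> < \<epsilon>" if xy: "x \<in> Q" "y \<in> Q" "\<forall>i\<in>I. \<bar>x i - y i\<bar> \<le> len i" for x y
  proof -
    have "adj (idx x) (idx y)" using xy by (intro idx_adj) (auto simp: Q)
    then have "adj (idx x) (idx y)" "adj (idx y) (idx x)" by (auto simp: adj_def)
    then have "p (idx x) - p (idx y) \<le> \<epsilon> / 4" "p (idx y) - p (idx x) \<le> \<epsilon> / 4"
      using gp(2)[OF idx_in_ix[of x] idx_in_ix[of y]] gp(2)[OF idx_in_ix[of y] idx_in_ix[of x]]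
      by simp_all
    then show ?thesis using gp(3)[OF xy(1)] gp(3)[OF xy(2)] \<open>0 < \<epsilon>\<close> by linarith
  qed
  show "\<exists>d. (\<forall>i\<in>I. 0 < d i) \<and> (\<forall>x\<in>Q. \<forall>y\<in>Q. (\<forall>i\<in>I. \<bar>x i - y i\<bar> \<le> d i) \<longrightarrow> \<bar>f_is x - f_is y\<bar> < \<epsilon>)"
    using lt len_pos by (intro exI[of _ len]) auto
qed

lemma variational:
  fixes g :: "(nat \<Rightarrow> real) \<Rightarrow> real"
  assumes g: "integrable (lborel_Pi I) (\<lambda>x. indicator Q x * g x)"
    and N: "N \<in> null_sets (lborel_Pi I)" "sig_mono_on I \<sigma> (Q - N) g"
  shows "(\<integral>x. indicator Q x * ((f x - f_is x) * (g x - f_is x) * w x) \<partial>lborel_Pi I) \<le> 0"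
proof -
  obtain W where W: "\<And>x. x \<in> Q \<Longrightarrow> \<bar>w x\<bar> \<le> W"
    using compact_imp_bounded[OF compact_continuous_image[OF w(1)]]
    unfolding bounded_iff by (auto simp: Q compact_rect)
  have W0: "0 \<le> W" and M0: "0 \<le> M" using Q_nonempty W f_le_M by fastforce+
  define K where "K = (\<integral>x. indicator Q x * ((2 * W + 2 * M) * \<bar>g x\<bar> + (4 * W * M + 2 * M * M)) \<partial>lborel_Pi I)"
  show ?thesis
  proof (rule nonpos_if_le_mult_eps[where K = K])
    show "0 \<le> K" unfolding K_def using W0 M0 by (intro integral_nonneg_AE AE_I2) auto
    fix e :: real assume e: "0 < e"
    obtain n p \<omega> where gp: "grid_proj I a b n \<sigma> f w p M m \<omega>" "\<omega> \<le> e"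
        "\<And>x. x \<in> Q \<Longrightarrow> \<bar>f_is x - p (grid.idx I a b n x)\<bar> \<le> e"
      using grid_approximation_f_is[OF e] by metis
    interpret grid_proj I a b n \<sigma> f w p M m \<omega> by (rule gp)
    have "(\<integral>x. indicator Q x * ((f x - f_is x) * (g x - f_is x) * w x) \<partial>lborel_Pi I) \<le> e * K"
      unfolding K_def
      by (rule variational_approx[folded Q, OF f_is_continuous f_is_le_M gp(3,2) W g N])
    then show "(\<integral>x. indicator Q x * ((f x - f_is x) * (g x - f_is x) * w x) \<partial>lborel_Pi I) \<le> K * e"
      by (simp add: mult.commute)
  qed
qed

section \<open>Transfer to the completed measure and minimality\<close>

abbreviation "\<nu> \<equiv> restrict_space (lebesgue_PiM I) Q"

lemma sets_Q: "Q \<in> sets (lborel_Pi I)" "Q \<in> sets (lebesgue_PiM I)"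
    "Q \<inter> space (lebesgue_PiM I) \<in> sets (lebesgue_PiM I)"
  using sets_rect[OF I, of a b] by (auto simp: Q lebesgue_PiM_def)

lemma space_\<nu>: "space \<nu> = Q"
  by (auto simp: space_restrict_space Q lebesgue_PiM_def rect_def space_PiM)

lemma measurable_\<nu>:
  fixes c :: "(nat \<Rightarrow> real) \<Rightarrow> real"
  assumes "continuous_on Q c"
  shows "c \<in> borel_measurable \<nu>"
  using measurable_completion[OF measurable_continuous_on_rect[OF I assms[unfolded Q]]]
  by (simp add: borel_measurable_restrict_space_iff sets_Q) (simp add: Q lebesgue_PiM_def)

lemma integral_\<nu>:
  fixes F :: "(nat \<Rightarrow> real) \<Rightarrow> real"
  assumes F: "integrable (lborel_Pi I) (\<lambda>x. indicator Q x * F x)"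
  shows "integrable \<nu> F" "integral\<^sup>L \<nu> F = (\<integral>x. indicator Q x * F x \<partial>lborel_Pi I)"
  using F borel_measurable_integrable[OF F]
  by (simp_all add: integrable_restrict_space integral_restrict_space sets_Q)
     (simp_all add: lebesgue_PiM_def integrable_completion integral_completion)

lemma integrable_\<nu>:
  fixes c :: "(nat \<Rightarrow> real) \<Rightarrow> real"
  assumes "continuous_on Q c"
  shows "integrable \<nu> c"
  by (intro integral_\<nu>(1)) (use integrable_continuous_on_rect[OF I] assms Q in auto)

lemma integrable_\<nu>_mult:
  fixes c g :: "(nat \<Rightarrow> real) \<Rightarrow> real"
  assumes c: "continuous_on Q c" and g: "integrable \<nu> g"
  shows "integrable \<nu> (\<lambda>x. c x * g x)"
proof -
  obtain B where B: "\<And>x. x \<in> Q \<Longrightarrow> \<bar>c x\<bar> \<le> B"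
    using compact_imp_bounded[OF compact_continuous_image[OF c]]
    unfolding bounded_iff by (auto simp: Q compact_rect)
  show ?thesis
  proof (rule Bochner_Integration.integrable_bound)
    show "integrable \<nu> (\<lambda>x. B * g x)" using g by simp
    show "(\<lambda>x. c x * g x) \<in> borel_measurable \<nu>"
      by (intro borel_measurable_times measurable_\<nu> c borel_measurable_integrable g)
    have "norm (c x * g x) \<le> norm (B * g x)" if "x \<in> Q" for x
      using B[OF that] by (auto simp: abs_mult intro!: mult_right_mono)
    then show "AE x in \<nu>. norm (c x * g x) \<le> norm (B * g x)"
      by (intro AE_I2) (simp add: space_\<nu>)
  qed
qed

lemma L2_on_integrable:
  assumes "h \<in> L2_on I Q"
  shows "integrable \<nu> h" "integrable \<nu> (\<lambda>x. (h x)\<^sup>2)"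
proof -
  show *: "integrable \<nu> (\<lambda>x. (h x)\<^sup>2)" using assms by (simp add: L2_on_def)
  show "integrable \<nu> h"
  proof (rule Bochner_Integration.integrable_bound)
    show "integrable \<nu> (\<lambda>x. 1 + (h x)\<^sup>2)"
      by (intro Bochner_Integration.integrable_add * integrable_\<nu> continuous_intros)
    have "\<bar>u\<bar> \<le> 1 + u\<^sup>2" for u :: real
    proof -
      have "0 \<le> (\<bar>u\<bar> - 1)\<^sup>2" by simp
      then have "2 * \<bar>u\<bar> \<le> 1 + u\<^sup>2" by (simp add: power2_diff)
      then show ?thesis by linarith
    qed
    then show "AE x in \<nu>. norm (h x) \<le> norm (1 + (h x)\<^sup>2)"
      by (intro AE_I2) simp
  qed (use assms in \<open>simp add: L2_on_def\<close>)
qed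

lemma continuous_on_L2: "continuous_on Q h \<Longrightarrow> h \<in> L2_on I Q"
  by (auto simp: L2_on_def intro!: measurable_\<nu> integrable_\<nu> continuous_intros)

lemma continuous_mono_L2_mono:
  assumes "continuous_on Q h" "sig_mono_on I \<sigma> Q h"
  shows "h \<in> L2_mono I \<sigma> Q"
  using continuous_on_L2[OF assms(1)] assms(2) unfolding L2_mono_def L2_eq_def
  by (auto intro!: bexI[of _ h] bexI[of _ "{}"])

text \<open>Representatives and exceptional sets belong to the completed measure, whereas the
  translation argument runs in the uncompleted one. Here \<open>N1\<close> covers the exceptional
  set by a null set of the product measure, and \<open>N2\<close> covers the points where the
  measurable replacement \<open>g\<close> differs.\<close>

lemma L2_mono_borel:
  assumes "h \<in> L2_mono I \<sigma> Q"
  obtains g N where "g \<in> borel_measurable (lborel_Pi I)" "AE x in \<nu>. h x = g x"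
    "N \<in> null_sets (lborel_Pi I)" "sig_mono_on I \<sigma> (Q - N) g"
proof -
  obtain h\<^sub>0 N where h0: "h\<^sub>0 \<in> L2_on I Q" "AE x in \<nu>. h\<^sub>0 x = h x"
    and N: "N \<in> null_sets \<nu>" "sig_mono_on I \<sigma> (Q - N) h\<^sub>0"
    using assms by (auto simp: L2_mono_def L2_eq_def)
  have "(\<lambda>x. indicator Q x * h\<^sub>0 x) \<in> borel_measurable (completion (lborel_Pi I))"
    using h0(1) sets_Q by (simp add: L2_on_def borel_measurable_restrict_space_iff lebesgue_PiM_def)
  then obtain g where g: "g \<in> borel_measurable (lborel_Pi I)"
      "AE x in lborel_Pi I. indicator Q x * h\<^sub>0 x = g x"
    using completion_ex_borel_measurable_real by blast
  obtain N1 where N1: "N1 \<in> null_sets (lborel_Pi I)" "N \<subseteq> N1"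
    using N(1) sets_Q by (auto simp: null_sets_restrict_space lebesgue_PiM_def null_sets_completion_iff2)
  obtain N2 where N2: "N2 \<in> null_sets (lborel_Pi I)"
      "{x \<in> space (lborel_Pi I). indicator Q x * h\<^sub>0 x \<noteq> g x} \<subseteq> N2"
    using g(2) by (auto elim!: AE_E intro: that)
  have eq: "h\<^sub>0 x = g x" if "x \<in> Q" "x \<notin> N2" for x
    using N2(2) that sets.sets_into_space[OF sets_Q(1)] by auto
  show thesis
  proof
    show "g \<in> borel_measurable (lborel_Pi I)" by (rule g)
    show "N1 \<union> N2 \<in> null_sets (lborel_Pi I)" using N1 N2 by auto
    show "sig_mono_on I \<sigma> (Q - (N1 \<union> N2)) g"
      using N(2) N1(2) eq by (fastforce simp: monotone_on_def)
    have "AE x in lborel_Pi I. x \<in> Q \<longrightarrow> h\<^sub>0 x = g x"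
      using g(2) by eventually_elim auto
    then have "AE x in lebesgue_PiM I. x \<in> Q \<longrightarrow> h\<^sub>0 x = g x"
      unfolding lebesgue_PiM_def by (rule AE_completion)
    then have "AE x in \<nu>. h\<^sub>0 x = g x"
      by (simp add: AE_restrict_space_iff sets_Q(3))
    with h0(2) show "AE x in \<nu>. h x = g x" by eventually_elim simp
  qed
qed

lemma variational_L2_mono:
  assumes h: "h \<in> L2_mono I \<sigma> Q"
  shows "(\<integral>x. (f x - f_is x) * (h x - f_is x) * w x \<partial>\<nu>) \<le> 0"
proof -
  obtain g N where g: "g \<in> borel_measurable (lborel_Pi I)" "AE x in \<nu>. h x = g x"
    and N: "N \<in> null_sets (lborel_Pi I)" "sig_mono_on I \<sigma> (Q - N) g"
    using L2_mono_borel[OF h] .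
  have h2: "h \<in> L2_on I Q" using h by (simp add: L2_mono_def)
  have hm: "h \<in> borel_measurable \<nu>" using h2 by (simp add: L2_on_def)
  have Qg: "(\<lambda>x. indicator Q x * g x) \<in> borel_measurable (lborel_Pi I)"
    using g(1) sets_Q(1) by measurable
  then have "(\<lambda>x. indicator Q x * g x) \<in> borel_measurable (lebesgue_PiM I)"
    by (simp add: lebesgue_PiM_def measurable_completion)
  then have gm: "g \<in> borel_measurable \<nu>"
    using sets_Q by (simp add: borel_measurable_restrict_space_iff)
  have "integrable \<nu> g"
    using L2_on_integrable(1)[OF h2] integrable_cong_AE[OF hm gm g(2)] by simp
  then have "integrable (lborel_Pi I) (\<lambda>x. indicator Q x * g x)"
    using Qg sets_Q by (simp add: integrable_restrict_space lebesgue_PiM_def integrable_completion)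
  note gi = this
  have "integrable (lborel_Pi I) (\<lambda>x. indicator Q x * ((f x - f_is x) * w x * g x)
      - indicator Q x * ((f x - f_is x) * w x * f_is x))"
    unfolding Q
    by (intro Bochner_Integration.integrable_diff integrable_rect_mult integrable_continuous_on_rect I
        gi[unfolded Q] continuous_intros f[unfolded Q] w(1)[unfolded Q] f_is_continuous[unfolded Q])
  then have i: "integrable (lborel_Pi I) (\<lambda>x. indicator Q x * ((f x - f_is x) * (g x - f_is x) * w x))"
    by (simp add: algebra_simps)
  have cm: "(\<lambda>x. f x - f_is x) \<in> borel_measurable \<nu>" "f_is \<in> borel_measurable \<nu>" "w \<in> borel_measurable \<nu>"
    by (intro measurable_\<nu> continuous_intros f w(1) f_is_continuous)+
  have "(\<integral>x. (f x - f_is x) * (h x - f_is x) * w x \<partial>\<nu>) = (\<integral>x. (f x - f_is x) * (g x - f_is x) * w x \<partial>\<nu>)"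
  proof (rule integral_cong_AE)
    show "AE x in \<nu>. (f x - f_is x) * (h x - f_is x) * w x = (f x - f_is x) * (g x - f_is x) * w x"
      using g(2) by eventually_elim simp
  qed (intro borel_measurable_times borel_measurable_diff cm hm gm)+
  also have "\<dots> = (\<integral>x. indicator Q x * ((f x - f_is x) * (g x - f_is x) * w x) \<partial>lborel_Pi I)"
    by (rule integral_\<nu>(2)[OF i])
  also have "\<dots> \<le> 0" by (rule variational[OF gi N])
  finally show ?thesis .
qed

text \<open>In the expansion of the square around \<open>f_is\<close> the cross term has a sign by
  \<open>variational_L2_mono\<close>. Keeping the quadratic remainder gives minimality and
  uniqueness together.\<close>

lemma weighted_sq_dist_ge:
  assumes h: "h \<in> L2_mono I \<sigma> Q"
  shows "integrable \<nu> (\<lambda>x. (h x - f_is x)\<^sup>2 * w x)"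
    "weighted_sq_dist I Q w f f_is + (\<integral>x. (h x - f_is x)\<^sup>2 * w x \<partial>\<nu>) \<le> weighted_sq_dist I Q w f h"
proof -
  have h2: "h \<in> L2_on I Q" using h by (simp add: L2_mono_def)
  note hi = L2_on_integrable[OF h2]
  note cont = f w(1) f_is_continuous
  have "integrable \<nu> (\<lambda>x. w x * (h x)\<^sup>2 - (2 * w x * f_is x) * h x + w x * (f_is x)\<^sup>2)"
    by (intro Bochner_Integration.integrable_add Bochner_Integration.integrable_diff
        integrable_\<nu>_mult hi integrable_\<nu> continuous_intros cont)
  then show i1: "integrable \<nu> (\<lambda>x. (h x - f_is x)\<^sup>2 * w x)"
    by (simp add: power2_diff algebra_simps)
  have i0: "integrable \<nu> (\<lambda>x. \<bar>f x - f_is x\<bar>\<^sup>2 * w x)"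
    by (intro integrable_\<nu> continuous_intros cont)
  have "integrable \<nu> (\<lambda>x. ((f x - f_is x) * w x) * h x - (f x - f_is x) * w x * f_is x)"
    by (intro Bochner_Integration.integrable_diff integrable_\<nu>_mult hi integrable_\<nu> continuous_intros cont)
  then have i2: "integrable \<nu> (\<lambda>x. (f x - f_is x) * (h x - f_is x) * w x)"
    by (simp add: algebra_simps)
  have "weighted_sq_dist I Q w f h = (\<integral>x. \<bar>f x - f_is x\<bar>\<^sup>2 * w x
      - 2 * ((f x - f_is x) * (h x - f_is x) * w x) + (h x - f_is x)\<^sup>2 * w x \<partial>\<nu>)"
    unfolding weighted_sq_dist_def
    by (intro Bochner_Integration.integral_cong refl) (simp add: power2_eq_square algebra_simps)
  also have "\<dots> = weighted_sq_dist I Q w f f_is - 2 * (\<integral>x. (f x - f_is x) * (h x - f_is x) * w x \<partial>\<nu>)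
      + (\<integral>x. (h x - f_is x)\<^sup>2 * w x \<partial>\<nu>)"
    unfolding weighted_sq_dist_def using i0 i1 i2 by simp
  finally show "weighted_sq_dist I Q w f f_is + (\<integral>x. (h x - f_is x)\<^sup>2 * w x \<partial>\<nu>) \<le> weighted_sq_dist I Q w f h"
    using variational_L2_mono[OF h] by simp
qed

lemma represents_proj_f_is: "represents_proj I \<sigma> Q w f f_is"
proof -
  let ?D = "weighted_sq_dist I Q w f"
  have f_is: "f_is \<in> L2_mono I \<sigma> Q"
    by (intro continuous_mono_L2_mono f_is_continuous f_is_mono)
  have nn: "AE x in \<nu>. 0 \<le> (h x - f_is x)\<^sup>2 * w x" for h
    using w(2) by (intro AE_I2) (simp add: space_\<nu> less_imp_le)
  have ge: "?D f_is \<le> ?D h" if "h \<in> L2_mono I \<sigma> Q" for h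
    using weighted_sq_dist_ge(2)[OF that] integral_nonneg_AE[OF nn[of h]] by simp
  have "L2_eq I Q h f_is" if h: "is_arg_min ?D (\<lambda>h. h \<in> L2_mono I \<sigma> Q) h" for h
  proof -
    have hm: "h \<in> L2_mono I \<sigma> Q" "?D h \<le> ?D f_is" using h f_is by (auto simp: is_arg_min_def not_less)
    \<comment> \<open>A second minimiser leaves no room for the quadratic remainder; positivity of
      \<open>w\<close> then forces equality almost everywhere.\<close>
    have "(\<integral>x. (h x - f_is x)\<^sup>2 * w x \<partial>\<nu>) = 0"
      using weighted_sq_dist_ge(2)[OF hm(1)] hm(2) integral_nonneg_AE[OF nn[of h]] by simp
    then have "AE x in \<nu>. (h x - f_is x)\<^sup>2 * w x = 0"
      using integral_nonneg_eq_0_iff_AE[OF weighted_sq_dist_ge(1)[OF hm(1)] nn] by simp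
    with AE_space show ?thesis
      unfolding L2_eq_def
    proof eventually_elim
      case (elim x)
      then show ?case using w(2)[of x] by (simp add: space_\<nu>)
    qed
  qed
  then show ?thesis
    using f_is ge unfolding represents_proj_def is_arg_min_def by (auto simp: not_less)
qed

text \<open>The points where two continuous functions differ form a relatively open subset of
  \<open>Q\<close>, which has positive measure unless it is empty.\<close>

lemma continuous_L2_eq:
  assumes g: "continuous_on Q g" "continuous_on Q h" "L2_eq I Q g h" and x: "x \<in> Q"
  shows "g x = h x"
proof (rule ccontr)
  assume neq: "g x \<noteq> h x"
  define E where "E = {y\<in>Q. g y - h y \<noteq> 0}"
  have "openin (top_of_set Q) (Q \<inter> (\<lambda>y. g y - h y) -` (- {0}))"
    by (intro continuous_openin_preimage_gen continuous_intros g)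
  also have "Q \<inter> (\<lambda>y. g y - h y) -` (- {0}) = E" by (auto simp: E_def)
  finally have E: "openin (top_of_set (rect I a b)) E" by (simp add: Q)
  have "AE y in lebesgue_PiM I. y \<in> Q \<longrightarrow> g y = h y"
    using g(3) by (simp add: L2_eq_def AE_restrict_space_iff sets_Q(3))
  then have "AE y in lborel_Pi I. y \<in> Q \<longrightarrow> g y = h y"
    unfolding lebesgue_PiM_def by (simp only: AE_completion_iff)
  then have "AE y in lborel_Pi I. y \<notin> E"
    by eventually_elim (auto simp: E_def)
  then have "emeasure (lborel_Pi I) E = 0"
    using sets_openin_rect[OF I E]
    by (subst (asm) AE_iff_measurable[of E]) (auto dest: sets.sets_into_space)
  moreover have "0 < emeasure (lborel_Pi I) E"
    using x neq by (intro emeasure_openin_rect_pos[OF I ab E, of x]) (auto simp: E_def)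
  ultimately show False by simp
qed

end

theorem theorem6p3:
  fixes d :: nat and a b :: "nat \<Rightarrow> real" and \<sigma> :: "nat \<Rightarrow> int"
    and I :: "nat set" and Q :: "(nat \<Rightarrow> real) set"
    and f w :: "(nat \<Rightarrow> real) \<Rightarrow> real"
  assumes I: "I = {1..d}"
    and ab: "\<And>i. i \<in> I \<Longrightarrow> a i < b i"
    and \<sigma>: "\<And>i. i \<in> I \<Longrightarrow> \<sigma> i \<in> {-1, 0, 1}"
    and Q: "Q = rect I a b"
    and f: "continuous_on Q f"
    and w: "continuous_on Q w" "\<And>x. x \<in> Q \<Longrightarrow> w x > 0"
  shows "\<exists>f\<^sub>0.
     (continuous_on Q f\<^sub>0 \<and> sig_mono_on I \<sigma> Q f\<^sub>0 \<and> represents_proj I \<sigma> Q w f f\<^sub>0) \<and>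
     (\<forall>g. continuous_on Q g \<and> sig_mono_on I \<sigma> Q g \<and> represents_proj I \<sigma> Q w f g
            \<longrightarrow> (\<forall>x\<in>Q. g x = f\<^sub>0 x)) \<and>
     (\<forall>x\<in>Q.
        av_is (hat_coords I \<sigma>) \<sigma> (rect (hat_coords I \<sigma>) a b) (slice I \<sigma> w x) (slice I \<sigma> f x)
            (restrict x (hat_coords I \<sigma>)) = f\<^sub>0 x \<and>
        f\<^sub>0 x =
        av_si (hat_coords I \<sigma>) \<sigma> (rect (hat_coords I \<sigma>) a b) (slice I \<sigma> w x) (slice I \<sigma> f x)
            (restrict x (hat_coords I \<sigma>)))"
proof -
  interpret isotonic_problem I a b \<sigma> f w Q
    using assms by unfold_locales auto
  show ?thesis
  proof (intro exI[of _ f_is] conjI allI impI ballI)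
    fix g x assume g: "continuous_on Q g \<and> sig_mono_on I \<sigma> Q g \<and> represents_proj I \<sigma> Q w f g"
      and x: "x \<in> Q"
    have "L2_eq I Q g f_is"
      using g represents_proj_f_is by (auto simp: represents_proj_def)
    with g x show "g x = f_is x" by (intro continuous_L2_eq f_is_continuous) auto
  next
    fix x assume "x \<in> Q"
    then show "f_is x = av_si (hat_coords I \<sigma>) \<sigma> (rect (hat_coords I \<sigma>) a b) (slice I \<sigma> w x)
        (slice I \<sigma> f x) (restrict x (hat_coords I \<sigma>))"
      using f_si_eq[of x] by (simp add: f_si_def)
  qed (fact f_is_continuous f_is_mono represents_proj_f_is | simp add: f_is_def)+
qed

end
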